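(* Let $\Phi$ be an irreducible affine reflection system whose underlying finite root system $\mathring{\Phi}$ is of type $BC_n$, $n\geq2$. A subset $\Psi\subseteq\Phi$ is a maximal closed subroot system if and only if one of the following cases holds: (1) $\Psi=\widehat{A_J}$ for some $\emptyset\subseteq J\subsetneq\{1,\dots,n\}$, where $J\neq\emptyset$ if $\Lambda_s\neq\Lambda_\ell$. (2) There exists a maximal closed subroot system $\Psi'$ in $\Phi^{B_n}$ with semi-closed gradient such that $$\Psi=\Psi'\cup\{\pm2\epsilon_i\oplus\Lambda_d:1\leq i\leq n\}.$$ (3) There exists a maximal closed subroot system $\Psi'$ in $\Phi^{B_n}$ with full gradient such that $$\Psi=\Psi'\cup\{\pm2\epsilon_i\oplus\big((Z_{\pm\epsilon_i-\epsilon_{i+1}}(\Psi')+Z_{\pm\epsilon_i+\epsilon_{i+1}}(\Psi'))\cap\Lambda_d\big):1\leq i\leq n\},$$ where $\epsilon_{n+1}=\epsilon_1$ and the same sign is taken for all three occurrences of $\pm$.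
   Context: Root system $BC_n$: let $V$ be a Euclidean space with inner product $(\cdot,\cdot)$ and orthonormal basis $\epsilon_1,\dots,\epsilon_n$. $\mathring{\Phi}=\mathring{\Phi}_s\cup\mathring{\Phi}_\ell\cup\mathring{\Phi}_d$ with $\mathring{\Phi}_s=\{\pm\epsilon_i\}$, $\mathring{\Phi}_\ell=\{\pm\epsilon_i\pm\epsilon_j:i\neq j\}$, $\mathring{\Phi}_d=\{\pm2\epsilon_i\}$. Put $\alpha^\vee=2\alpha/(\alpha,\alpha)$, $s_\alpha(v)=v-(v,\alpha^\vee)\alpha$. Extension datum: a family $(\Lambda_\alpha)_{\alpha\in\mathring{\Phi}\cup\{0\}}$ of subsets of a finite-dimensional real vector space $Y$ such that (1) $\Lambda_\beta-(\beta,\alpha^\vee)\Lambda_\alpha\subseteq\Lambda_{s_\alpha(\beta)}$ for all $\alpha,\beta\in\mathring{\Phi}$; (2) $0\in\Lambda_\alpha$ for $\alpha\in\mathring{\Phi}_s\cup\mathring{\Phi}_\ell\cup\{0\}$ and $\Lambda_\alpha\neq\emptyset$ for $\alpha\in\mathring{\Phi}_d$; (3) $Y$ is the real span of $\bigcup_\alpha\Lambda_\alpha$. Then $\Lambda_\alpha$ is constant on each of $\mathring{\Phi}_s,\mathring{\Phi}_\ell,\mathring{\Phi}_d$, with values denoted $\Lambda_s,\Lambda_\ell,\Lambda_d$. $\Lambda_\ell$ is a subgroup of $Y$ for $n\ge3$; it is a standing assumption that $\Lambda_\ell$ is a subgroup also for $n=2$. Affine reflection system: up to isomorphism, the irreducible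 affine reflection systems of type $BC_n$ are $\Phi=\bigcup_{\alpha\in\mathring{\Phi}\cup\{0\}}\alpha\oplus\Lambda_\alpha\subset V\oplus Y$ with form $(v_1\oplus y_1,v_2\oplus y_2)_X=(v_1,v_2)$. Here $\alpha\oplus S=\{\alpha\oplus y:y\in S\}$ for $S\subseteq Y$, and displayed sets of such expressions denote their unions. Real roots: $\Phi^{\mathrm{re}}=\bigcup_{\alpha\in\mathring{\Phi}}\alpha\oplus\Lambda_\alpha$; $s_{\alpha\oplus y}(\beta\oplus z)=s_\alpha(\beta)\oplus(z-(\beta,\alpha^\vee)y)$. Subroot systems: a proper non-empty subset $\Psi\subsetneq\Phi^{\mathrm{re}}$ is a subroot system if $s_a(b)\in\Psi$ for all $a,b\in\Psi$; closed if $a,b\in\Psi$, $a+b\in\Phi^{\mathrm{re}}$ imply $a+b\in\Psi$; a maximal closed subroot system if it is a closed subroot system and there is no closed subroot system $\Psi''$ with $\Psi\subsetneq\Psi''\subsetneq\Phi^{\mathrm{re}}$. $\Phi^{B_n}=\{\alpha\oplus y:\alpha\in\mathring{\Phi}_s\cup\mathring{\Phi}_\ell,\ y\in\Lambda_\alpha\}$. A proper non-empty subset $\Psi'\subsetneq\Phi^{B_n}$ is a subroot system in $\Phi^{B_n}$ if $s_a(b)\in\Psi'$ for all $a,b\in\Psi'$; closed in $\Phi^{B_n}$ if $a,b\in\Psi'$, $a+b\in\Phi^{B_n}$ imply $a+b\in\Psi'$; a maximal closed subroot system in $\Phi^{B_n}$ if it is a closed subroot system in $\Phi^{B_n}$ and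 there is no closed subroot system $\Psi''$ in $\Phi^{B_n}$ with $\Psi'\subsetneq\Psi''\subsetneq\Phi^{B_n}$. For $\Psi'\subseteq\Phi^{B_n}$ put $\mathrm{Gr}(\Psi')=\{\alpha:\exists y,\ \alpha\oplus y\in\Psi'\}\subseteq\mathring{\Phi}_s\cup\mathring{\Phi}_\ell$ and $Z_\alpha(\Psi')=\{y\in\Lambda_\alpha:\alpha\oplus y\in\Psi'\}$. The gradient is full if $\mathrm{Gr}(\Psi')=\mathring{\Phi}_s\cup\mathring{\Phi}_\ell$. It is closed if $\alpha,\beta\in\mathrm{Gr}(\Psi')$ and $\alpha+\beta\in\mathring{\Phi}_s\cup\mathring{\Phi}_\ell$ imply $\alpha+\beta\in\mathrm{Gr}(\Psi')$; it is semi-closed if it is not closed and whenever $\alpha,\beta\in\mathrm{Gr}(\Psi')$ with $\alpha+\beta\in(\mathring{\Phi}_s\cup\mathring{\Phi}_\ell)\setminus\mathrm{Gr}(\Psi')$ one has $\alpha,\beta\in\mathring{\Phi}_s$ and $\alpha+\beta\in\mathring{\Phi}_\ell$. For $J\subseteq\{1,\dots,n\}$: $A_J=\{\pm2\epsilon_i,\ \pm\epsilon_j:1\le i\le n,\ j\in J\}\cup\{\pm\epsilon_r\pm\epsilon_s:\ r\neq s,\ r,s\in J\text{ or }r,s\notin J\}$ and $\widehat{A_J}=\{\alpha\oplus y:\alpha\in A_J,\ y\in\Lambda_\alpha\}$. *)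

theory Defs
  imports "HOL-Analysis.Analysis" "HOL-Library.Set_Algebras"
begin

definition orthonormal_basis :: "nat \<Rightarrow> (nat \<Rightarrow> 'v::euclidean_space) \<Rightarrow> bool" where
  "orthonormal_basis n \<epsilon> \<longleftrightarrow>
     (\<forall>i\<in>{1..n}. \<forall>j\<in>{1..n}. \<epsilon> i \<bullet> \<epsilon> j = (if i = j then 1 else 0)) \<and>
     span (\<epsilon> ` {1..n}) = UNIV"

abbreviation signs :: "real set" where
  "signs \<equiv> {1, - 1}"

definition short_roots :: "nat \<Rightarrow> (nat \<Rightarrow> 'v::euclidean_space) \<Rightarrow> 'v set" where
  "short_roots n \<epsilon> = {\<sigma> *\<^sub>R \<epsilon> i | \<sigma> i. \<sigma> \<in> signs \<and> i \<in> {1..n}}"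

definition long_roots :: "nat \<Rightarrow> (nat \<Rightarrow> 'v::euclidean_space) \<Rightarrow> 'v set" where
  "long_roots n \<epsilon> = {\<sigma> *\<^sub>R \<epsilon> i + \<tau> *\<^sub>R \<epsilon> j | \<sigma> \<tau> i j.
     \<sigma> \<in> signs \<and> \<tau> \<in> signs \<and> i \<in> {1..n} \<and> j \<in> {1..n} \<and> i \<noteq> j}"

definition divisible_roots :: "nat \<Rightarrow> (nat \<Rightarrow> 'v::euclidean_space) \<Rightarrow> 'v set" where
  "divisible_roots n \<epsilon> = {\<sigma> *\<^sub>R (2 *\<^sub>R \<epsilon> i) | \<sigma> i. \<sigma> \<in> signs \<and> i \<in> {1..n}}"

definition BC_roots :: "nat \<Rightarrow> (nat \<Rightarrow> 'v::euclidean_space) \<Rightarrow> 'v set" where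
  "BC_roots n \<epsilon> = short_roots n \<epsilon> \<union> long_roots n \<epsilon> \<union> divisible_roots n \<epsilon>"

definition B_roots :: "nat \<Rightarrow> (nat \<Rightarrow> 'v::euclidean_space) \<Rightarrow> 'v set" where
  "B_roots n \<epsilon> = short_roots n \<epsilon> \<union> long_roots n \<epsilon>"

definition coroot :: "'v::euclidean_space \<Rightarrow> 'v" where
  "coroot \<alpha> = (2 / (\<alpha> \<bullet> \<alpha>)) *\<^sub>R \<alpha>"

definition refl_root :: "'v::euclidean_space \<Rightarrow> 'v \<Rightarrow> 'v" where
  "refl_root \<alpha> v = v - (v \<bullet> coroot \<alpha>) *\<^sub>R \<alpha>"

text \<open>
  The space $Y$ is the set \<open>Y\<close> inside a real vector space; being a span, it is a subspace and
  contains every \<open>\<Lambda> \<alpha>\<close> with \<open>\<alpha>\<close> a root or zero. The values of \<open>\<Lambda>\<close> elsewhere are irrelevant.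
\<close>

definition extension_datum ::
  "nat \<Rightarrow> (nat \<Rightarrow> 'v::euclidean_space) \<Rightarrow> 'y::real_vector set \<Rightarrow> ('v \<Rightarrow> 'y set) \<Rightarrow> bool" where
  "extension_datum n \<epsilon> Y \<Lambda> \<longleftrightarrow>
     (\<exists>B. finite B \<and> Y = span B) \<and>
     (\<forall>\<alpha>\<in>BC_roots n \<epsilon>. \<forall>\<beta>\<in>BC_roots n \<epsilon>.
        {y - (\<beta> \<bullet> coroot \<alpha>) *\<^sub>R z | y z. y \<in> \<Lambda> \<beta> \<and> z \<in> \<Lambda> \<alpha>} \<subseteq> \<Lambda> (refl_root \<alpha> \<beta>)) \<and>
     (\<forall>\<alpha>\<in>short_roots n \<epsilon> \<union> long_roots n \<epsilon> \<union> {0}. 0 \<in> \<Lambda> \<alpha>) \<and>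
     (\<forall>\<alpha>\<in>divisible_roots n \<epsilon>. \<Lambda> \<alpha> \<noteq> {}) \<and>
     Y = span (\<Union>\<alpha>\<in>BC_roots n \<epsilon> \<union> {0}. \<Lambda> \<alpha>)"

text \<open>
  For an extension datum, \<open>\<Lambda>\<close> is constant on the short, the long and the divisible roots
  (\<open>Lambda_short\<close>, \<open>Lambda_long\<close>, \<open>Lambda_divisible\<close> below), so its common values can be read
  off at one root of each kind.
\<close>

definition Lambda_s :: "(nat \<Rightarrow> 'v::euclidean_space) \<Rightarrow> ('v \<Rightarrow> 'y set) \<Rightarrow> 'y set" where
  "Lambda_s \<epsilon> \<Lambda> = \<Lambda> (\<epsilon> 1)"

definition Lambda_l :: "(nat \<Rightarrow> 'v::euclidean_space) \<Rightarrow> ('v \<Rightarrow> 'y set) \<Rightarrow> 'y set" where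
  "Lambda_l \<epsilon> \<Lambda> = \<Lambda> (\<epsilon> 1 + \<epsilon> 2)"

definition Lambda_d :: "(nat \<Rightarrow> 'v::euclidean_space) \<Rightarrow> ('v \<Rightarrow> 'y set) \<Rightarrow> 'y set" where
  "Lambda_d \<epsilon> \<Lambda> = \<Lambda> (2 *\<^sub>R \<epsilon> 1)"

definition add_subgroup :: "'y::ab_group_add set \<Rightarrow> 'y set \<Rightarrow> bool" where
  "add_subgroup H Y \<longleftrightarrow>
     H \<subseteq> Y \<and> 0 \<in> H \<and> (\<forall>x\<in>H. \<forall>y\<in>H. x + y \<in> H) \<and> (\<forall>x\<in>H. - x \<in> H)"

text \<open>
  The element $\alpha \oplus y$ is the pair \<open>(\<alpha>, y)\<close>, and $\alpha \oplus S$ is \<open>{\<alpha>} \<times> S\<close>.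
\<close>

definition affine_system ::
  "nat \<Rightarrow> (nat \<Rightarrow> 'v::euclidean_space) \<Rightarrow> ('v \<Rightarrow> 'y::real_vector set) \<Rightarrow> ('v \<times> 'y) set" where
  "affine_system n \<epsilon> \<Lambda> = (SIGMA \<alpha>:BC_roots n \<epsilon> \<union> {0}. \<Lambda> \<alpha>)"

definition real_roots ::
  "nat \<Rightarrow> (nat \<Rightarrow> 'v::euclidean_space) \<Rightarrow> ('v \<Rightarrow> 'y::real_vector set) \<Rightarrow> ('v \<times> 'y) set" where
  "real_roots n \<epsilon> \<Lambda> = (SIGMA \<alpha>:BC_roots n \<epsilon>. \<Lambda> \<alpha>)"

definition B_real_roots ::
  "nat \<Rightarrow> (nat \<Rightarrow> 'v::euclidean_space) \<Rightarrow> ('v \<Rightarrow> 'y::real_vector set) \<Rightarrow> ('v \<times> 'y) set" where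
  "B_real_roots n \<epsilon> \<Lambda> = (SIGMA \<alpha>:B_roots n \<epsilon>. \<Lambda> \<alpha>)"

definition refl_affine :: "'v::euclidean_space \<times> 'y::real_vector \<Rightarrow> 'v \<times> 'y \<Rightarrow> 'v \<times> 'y" where
  "refl_affine a b =
     (refl_root (fst a) (fst b), snd b - (fst b \<bullet> coroot (fst a)) *\<^sub>R snd a)"

text \<open>The ambient set \<open>R\<close> is either the set of all real roots or the one over $B_n$.\<close>

definition subroot_system ::
  "('v::euclidean_space \<times> 'y::real_vector) set \<Rightarrow> ('v \<times> 'y) set \<Rightarrow> bool" where
  "subroot_system R \<Psi> \<longleftrightarrow>
     \<Psi> \<subset> R \<and> \<Psi> \<noteq> {} \<and> (\<forall>a\<in>\<Psi>. \<forall>b\<in>\<Psi>. refl_affine a b \<in> \<Psi>)"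

definition closed_subroot_system ::
  "('v::euclidean_space \<times> 'y::real_vector) set \<Rightarrow> ('v \<times> 'y) set \<Rightarrow> bool" where
  "closed_subroot_system R \<Psi> \<longleftrightarrow>
     subroot_system R \<Psi> \<and> (\<forall>a\<in>\<Psi>. \<forall>b\<in>\<Psi>. a + b \<in> R \<longrightarrow> a + b \<in> \<Psi>)"

definition maximal_closed_subroot_system ::
  "('v::euclidean_space \<times> 'y::real_vector) set \<Rightarrow> ('v \<times> 'y) set \<Rightarrow> bool" where
  "maximal_closed_subroot_system R \<Psi> \<longleftrightarrow>
     closed_subroot_system R \<Psi> \<and>
     \<not> (\<exists>\<Psi>''. closed_subroot_system R \<Psi>'' \<and> \<Psi> \<subset> \<Psi>'' \<and> \<Psi>'' \<subset> R)"

definition gradient :: "('v \<times> 'y) set \<Rightarrow> 'v set" where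
  "gradient \<Psi> = {\<alpha>. \<exists>y. (\<alpha>, y) \<in> \<Psi>}"

definition fibre :: "('v \<Rightarrow> 'y set) \<Rightarrow> ('v \<times> 'y) set \<Rightarrow> 'v \<Rightarrow> 'y set" where
  "fibre \<Lambda> \<Psi> \<alpha> = {y \<in> \<Lambda> \<alpha>. (\<alpha>, y) \<in> \<Psi>}"

definition full_gradient ::
  "nat \<Rightarrow> (nat \<Rightarrow> 'v::euclidean_space) \<Rightarrow> ('v \<times> 'y) set \<Rightarrow> bool" where
  "full_gradient n \<epsilon> \<Psi> \<longleftrightarrow> gradient \<Psi> = B_roots n \<epsilon>"

definition closed_gradient ::
  "nat \<Rightarrow> (nat \<Rightarrow> 'v::euclidean_space) \<Rightarrow> ('v \<times> 'y) set \<Rightarrow> bool" where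
  "closed_gradient n \<epsilon> \<Psi> \<longleftrightarrow>
     (\<forall>\<alpha>\<in>gradient \<Psi>. \<forall>\<beta>\<in>gradient \<Psi>. \<alpha> + \<beta> \<in> B_roots n \<epsilon> \<longrightarrow> \<alpha> + \<beta> \<in> gradient \<Psi>)"

definition semi_closed_gradient ::
  "nat \<Rightarrow> (nat \<Rightarrow> 'v::euclidean_space) \<Rightarrow> ('v \<times> 'y) set \<Rightarrow> bool" where
  "semi_closed_gradient n \<epsilon> \<Psi> \<longleftrightarrow>
     \<not> closed_gradient n \<epsilon> \<Psi> \<and>
     (\<forall>\<alpha>\<in>gradient \<Psi>. \<forall>\<beta>\<in>gradient \<Psi>. \<alpha> + \<beta> \<in> B_roots n \<epsilon> - gradient \<Psi> \<longrightarrow>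
        \<alpha> \<in> short_roots n \<epsilon> \<and> \<beta> \<in> short_roots n \<epsilon> \<and> \<alpha> + \<beta> \<in> long_roots n \<epsilon>)"

definition A_roots :: "nat \<Rightarrow> (nat \<Rightarrow> 'v::euclidean_space) \<Rightarrow> nat set \<Rightarrow> 'v set" where
  "A_roots n \<epsilon> J =
     {\<sigma> *\<^sub>R (2 *\<^sub>R \<epsilon> i) | \<sigma> i. \<sigma> \<in> signs \<and> i \<in> {1..n}} \<union>
     {\<sigma> *\<^sub>R \<epsilon> j | \<sigma> j. \<sigma> \<in> signs \<and> j \<in> J} \<union>
     {\<sigma> *\<^sub>R \<epsilon> r + \<tau> *\<^sub>R \<epsilon> s | \<sigma> \<tau> r s. \<sigma> \<in> signs \<and> \<tau> \<in> signs \<and>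
        r \<in> {1..n} \<and> s \<in> {1..n} \<and> r \<noteq> s \<and> (r \<in> J \<and> s \<in> J \<or> r \<notin> J \<and> s \<notin> J)}"

definition A_hat ::
  "nat \<Rightarrow> (nat \<Rightarrow> 'v::euclidean_space) \<Rightarrow> ('v \<Rightarrow> 'y set) \<Rightarrow> nat set \<Rightarrow> ('v \<times> 'y) set" where
  "A_hat n \<epsilon> \<Lambda> J = (SIGMA \<alpha>:A_roots n \<epsilon> J. \<Lambda> \<alpha>)"

definition cyc_succ :: "nat \<Rightarrow> nat \<Rightarrow> nat" where
  "cyc_succ n i = (if i = n then 1 else i + 1)"

definition semi_closed_extension ::
  "nat \<Rightarrow> (nat \<Rightarrow> 'v::euclidean_space) \<Rightarrow> ('v \<Rightarrow> 'y set) \<Rightarrow> ('v \<times> 'y) set \<Rightarrow> ('v \<times> 'y) set" where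
  "semi_closed_extension n \<epsilon> \<Lambda> \<Psi>' =
     \<Psi>' \<union> (\<Union>i\<in>{1..n}. \<Union>\<sigma>\<in>signs. {\<sigma> *\<^sub>R (2 *\<^sub>R \<epsilon> i)} \<times> Lambda_d \<epsilon> \<Lambda>)"

text \<open>Below, \<open>+\<close> between fibres is the elementwise sum of sets.\<close>

definition full_extension ::
  "nat \<Rightarrow> (nat \<Rightarrow> 'v::euclidean_space) \<Rightarrow> ('v \<Rightarrow> 'y::real_vector set) \<Rightarrow>
     ('v \<times> 'y) set \<Rightarrow> ('v \<times> 'y) set" where
  "full_extension n \<epsilon> \<Lambda> \<Psi>' =
     \<Psi>' \<union> (\<Union>i\<in>{1..n}. \<Union>\<sigma>\<in>signs.
       {\<sigma> *\<^sub>R (2 *\<^sub>R \<epsilon> i)} \<times>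
       ((fibre \<Lambda> \<Psi>' (\<sigma> *\<^sub>R \<epsilon> i - \<epsilon> (cyc_succ n i)) +
         fibre \<Lambda> \<Psi>' (\<sigma> *\<^sub>R \<epsilon> i + \<epsilon> (cyc_succ n i))) \<inter> Lambda_d \<epsilon> \<Lambda>))"

lemma orthonormal_basis_inner:
  assumes "orthonormal_basis n \<epsilon>" "i \<in> {1..n}" "j \<in> {1..n}"
  shows "\<epsilon> i \<bullet> \<epsilon> j = (if i = j then 1 else 0)"
  using assms unfolding orthonormal_basis_def by blast

lemma extension_datum_refl_mono:
  assumes "extension_datum n \<epsilon> Y \<Lambda>" "\<alpha> \<in> B_roots n \<epsilon>" "\<beta> \<in> BC_roots n \<epsilon>"
  shows "\<Lambda> \<beta> \<subseteq> \<Lambda> (refl_root \<alpha> \<beta>)"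
proof
  fix y assume y: "y \<in> \<Lambda> \<beta>"
  have z: "0 \<in> \<Lambda> \<alpha>" and a: "\<alpha> \<in> BC_roots n \<epsilon>"
    using assms(1,2) by (auto simp: extension_datum_def B_roots_def BC_roots_def)
  have "{y - (\<beta> \<bullet> coroot \<alpha>) *\<^sub>R z | y z. y \<in> \<Lambda> \<beta> \<and> z \<in> \<Lambda> \<alpha>} \<subseteq> \<Lambda> (refl_root \<alpha> \<beta>)"
    using assms(1,3) a unfolding extension_datum_def by blast
  moreover have "y \<in> {y - (\<beta> \<bullet> coroot \<alpha>) *\<^sub>R z | y z. y \<in> \<Lambda> \<beta> \<and> z \<in> \<Lambda> \<alpha>}"
    using y z by (intro CollectI exI[of _ y] exI[of _ 0]) auto
  ultimately show "y \<in> \<Lambda> (refl_root \<alpha> \<beta>)" by blast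
qed

lemma extension_datum_refl_eq:
  assumes "extension_datum n \<epsilon> Y \<Lambda>" "\<alpha> \<in> B_roots n \<epsilon>" "\<beta> \<in> BC_roots n \<epsilon>" "\<gamma> \<in> BC_roots n \<epsilon>"
    and "refl_root \<alpha> \<beta> = \<gamma>" "refl_root \<alpha> \<gamma> = \<beta>"
  shows "\<Lambda> \<beta> = \<Lambda> \<gamma>"
  using extension_datum_refl_mono[OF assms(1,2,3)] extension_datum_refl_mono[OF assms(1,2,4)] assms(5,6)
  by auto

context
  fixes n :: nat and \<epsilon> :: "nat \<Rightarrow> 'v::euclidean_space"
    and Y :: "'y::real_vector set" and \<Lambda> :: "'v \<Rightarrow> 'y set"
  assumes on: "orthonormal_basis n \<epsilon>" and ed: "extension_datum n \<epsilon> Y \<Lambda>"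
begin

lemma shortI: "\<lbrakk>\<sigma> \<in> signs; i \<in> {1..n}\<rbrakk> \<Longrightarrow> \<sigma> *\<^sub>R \<epsilon> i \<in> short_roots n \<epsilon>"
  unfolding short_roots_def by blast

lemma divisibleI: "\<lbrakk>\<sigma> \<in> signs; i \<in> {1..n}\<rbrakk> \<Longrightarrow> \<sigma> *\<^sub>R (2 *\<^sub>R \<epsilon> i) \<in> divisible_roots n \<epsilon>"
  unfolding divisible_roots_def by blast

lemma longI:
  "\<lbrakk>\<sigma> \<in> signs; \<tau> \<in> signs; i \<in> {1..n}; j \<in> {1..n}; i \<noteq> j\<rbrakk>
    \<Longrightarrow> \<sigma> *\<^sub>R \<epsilon> i + \<tau> *\<^sub>R \<epsilon> j \<in> long_roots n \<epsilon>"
  unfolding long_roots_def by blast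

lemma refl_unit: "i \<in> {1..n} \<Longrightarrow> refl_root (\<epsilon> i) v = v - (2 * (v \<bullet> \<epsilon> i)) *\<^sub>R \<epsilon> i"
  using orthonormal_basis_inner[OF on, of i i] by (simp add: refl_root_def coroot_def)

lemma refl_diff:
  assumes "i \<in> {1..n}" "j \<in> {1..n}" "i \<noteq> j"
  shows "refl_root (\<epsilon> i - \<epsilon> j) v = v - (v \<bullet> \<epsilon> i - v \<bullet> \<epsilon> j) *\<^sub>R (\<epsilon> i - \<epsilon> j)"
proof -
  have "(\<epsilon> i - \<epsilon> j) \<bullet> (\<epsilon> i - \<epsilon> j) = 2"
    using assms orthonormal_basis_inner[OF on] by (simp add: inner_diff_left inner_diff_right)
  then show ?thesis by (simp add: refl_root_def coroot_def inner_diff_right)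
qed

lemma unit_in_B: "i \<in> {1..n} \<Longrightarrow> \<epsilon> i \<in> B_roots n \<epsilon>"
  using shortI[of 1 i] by (simp add: B_roots_def)

lemma diff_in_B: "\<lbrakk>i \<in> {1..n}; j \<in> {1..n}; i \<noteq> j\<rbrakk> \<Longrightarrow> \<epsilon> i - \<epsilon> j \<in> B_roots n \<epsilon>"
  using longI[of 1 "-1" i j] by (simp add: B_roots_def)

lemma Lambda_flip:
  assumes "i \<in> {1..n}" "\<beta> \<in> BC_roots n \<epsilon>" "\<gamma> \<in> BC_roots n \<epsilon>"
    and "\<gamma> = \<beta> - (2 * (\<beta> \<bullet> \<epsilon> i)) *\<^sub>R \<epsilon> i"
  shows "\<Lambda> \<beta> = \<Lambda> \<gamma>"
proof (rule extension_datum_refl_eq[OF ed unit_in_B[OF assms(1)] assms(2,3)])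
  show "refl_root (\<epsilon> i) \<beta> = \<gamma>" using assms by (simp add: refl_unit)
  have "\<gamma> \<bullet> \<epsilon> i = - (\<beta> \<bullet> \<epsilon> i)"
    using assms(1,4) orthonormal_basis_inner[OF on, of i i] by (simp add: inner_diff_left)
  then show "refl_root (\<epsilon> i) \<gamma> = \<beta>" using assms by (simp add: refl_unit)
qed

lemma Lambda_swap:
  assumes "i \<in> {1..n}" "j \<in> {1..n}" "i \<noteq> j" "\<beta> \<in> BC_roots n \<epsilon>" "\<gamma> \<in> BC_roots n \<epsilon>"
    and "\<gamma> = \<beta> - (\<beta> \<bullet> \<epsilon> i - \<beta> \<bullet> \<epsilon> j) *\<^sub>R (\<epsilon> i - \<epsilon> j)"
  shows "\<Lambda> \<beta> = \<Lambda> \<gamma>"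
proof (rule extension_datum_refl_eq[OF ed diff_in_B[OF assms(1-3)] assms(4,5)])
  show "refl_root (\<epsilon> i - \<epsilon> j) \<beta> = \<gamma>" using assms by (simp add: refl_diff)
  have "\<gamma> \<bullet> \<epsilon> i - \<gamma> \<bullet> \<epsilon> j = - (\<beta> \<bullet> \<epsilon> i - \<beta> \<bullet> \<epsilon> j)"
    using assms(1-3,6) orthonormal_basis_inner[OF on] by (simp add: inner_diff_left)
  then have "refl_root (\<epsilon> i - \<epsilon> j) \<gamma> = \<gamma> - (- (\<beta> \<bullet> \<epsilon> i - \<beta> \<bullet> \<epsilon> j)) *\<^sub>R (\<epsilon> i - \<epsilon> j)"
    using refl_diff[OF assms(1-3), of \<gamma>] by (simp only:)
  also have "\<dots> = \<beta>" unfolding assms(6) by (simp only: scaleR_minus_left diff_minus_eq_add diff_add_cancel)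
  finally show "refl_root (\<epsilon> i - \<epsilon> j) \<gamma> = \<beta>" .
qed

lemma Lambda_short:
  assumes "\<alpha> \<in> short_roots n \<epsilon>"
  shows "\<Lambda> \<alpha> = Lambda_s \<epsilon> \<Lambda>"
proof -
  obtain \<sigma> i where a: "\<sigma> \<in> signs" "i \<in> {1..n}" "\<alpha> = \<sigma> *\<^sub>R \<epsilon> i"
    using assms by (auto simp: short_roots_def)
  have in_BC: "\<tau> *\<^sub>R \<epsilon> j \<in> BC_roots n \<epsilon>" if "\<tau> \<in> signs" "j \<in> {1..n}" for \<tau> j
    using shortI[OF that] by (simp add: BC_roots_def)
  have in_BC1: "\<epsilon> j \<in> BC_roots n \<epsilon>" if "j \<in> {1..n}" for j
    using in_BC[of 1 j] that by simp
  have one: "1 \<in> {1..n}" using a(2) by auto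
  have in_BC2: "- \<epsilon> j \<in> BC_roots n \<epsilon>" if "j \<in> {1..n}" for j
    using in_BC[of "-1" j] that by simp
  have "\<Lambda> (\<epsilon> i) = \<Lambda> (- \<epsilon> i)"
  proof (rule Lambda_flip[OF a(2) in_BC1[OF a(2)] in_BC2[OF a(2)]])
    show "- \<epsilon> i = \<epsilon> i - (2 * (\<epsilon> i \<bullet> \<epsilon> i)) *\<^sub>R \<epsilon> i"
      using orthonormal_basis_inner[OF on a(2) a(2)] by (simp add: scaleR_2)
  qed
  moreover have "\<alpha> = \<epsilon> i \<or> \<alpha> = - \<epsilon> i" using a(1,3) by auto
  ultimately have "\<Lambda> \<alpha> = \<Lambda> (\<epsilon> i)" by metis
  also have "\<Lambda> (\<epsilon> i) = \<Lambda> (\<epsilon> 1)"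
  proof (cases "i = 1")
    case False
    have "\<epsilon> i \<bullet> \<epsilon> i = 1" "\<epsilon> i \<bullet> \<epsilon> 1 = 0"
      using orthonormal_basis_inner[OF on a(2)] one a(2) False by auto
    then show ?thesis
      by (intro Lambda_swap[OF a(2) one False in_BC1[OF a(2)] in_BC1[OF one]]) simp
  qed simp
  finally show ?thesis by (simp add: Lambda_s_def)
qed

lemma Lambda_divisible:
  assumes "\<alpha> \<in> divisible_roots n \<epsilon>"
  shows "\<Lambda> \<alpha> = Lambda_d \<epsilon> \<Lambda>"
proof -
  obtain \<sigma> i where a: "\<sigma> \<in> signs" "i \<in> {1..n}" "\<alpha> = \<sigma> *\<^sub>R (2 *\<^sub>R \<epsilon> i)"
    using assms by (auto simp: divisible_roots_def)
  have in_BC: "\<tau> *\<^sub>R (2 *\<^sub>R \<epsilon> j) \<in> BC_roots n \<epsilon>" if "\<tau> \<in> signs" "j \<in> {1..n}" for \<tau> j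
    using divisibleI[OF that] by (simp add: BC_roots_def)
  have in_BC1: "2 *\<^sub>R \<epsilon> j \<in> BC_roots n \<epsilon>" if "j \<in> {1..n}" for j
    using in_BC[of 1 j] that by simp
  have in_BC2: "- (2 *\<^sub>R \<epsilon> j) \<in> BC_roots n \<epsilon>" if "j \<in> {1..n}" for j
    using in_BC[of "-1" j] that by simp
  have one: "1 \<in> {1..n}" using a(2) by auto
  have "\<Lambda> (2 *\<^sub>R \<epsilon> i) = \<Lambda> (- (2 *\<^sub>R \<epsilon> i))"
  proof (rule Lambda_flip[OF a(2) in_BC1[OF a(2)] in_BC2[OF a(2)]])
    have "2 *\<^sub>R \<epsilon> i - 4 *\<^sub>R \<epsilon> i = (2 - 4) *\<^sub>R \<epsilon> i" by (simp only: scaleR_diff_left)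
    then show "- (2 *\<^sub>R \<epsilon> i) = 2 *\<^sub>R \<epsilon> i - (2 * ((2 *\<^sub>R \<epsilon> i) \<bullet> \<epsilon> i)) *\<^sub>R \<epsilon> i"
      using orthonormal_basis_inner[OF on a(2) a(2)] by simp
  qed
  moreover have "\<alpha> = 2 *\<^sub>R \<epsilon> i \<or> \<alpha> = - (2 *\<^sub>R \<epsilon> i)" using a(1,3) by auto
  ultimately have "\<Lambda> \<alpha> = \<Lambda> (2 *\<^sub>R \<epsilon> i)" by metis
  also have "\<dots> = \<Lambda> (2 *\<^sub>R \<epsilon> 1)"
  proof (cases "i = 1")
    case False
    have "\<epsilon> i \<bullet> \<epsilon> i = 1" "\<epsilon> i \<bullet> \<epsilon> 1 = 0"
      using orthonormal_basis_inner[OF on a(2)] one a(2) False by auto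
    then show ?thesis
      by (intro Lambda_swap[OF a(2) one False in_BC1[OF a(2)] in_BC1[OF one]])
        (simp add: scaleR_diff_right)
  qed simp
  finally show ?thesis by (simp add: Lambda_d_def)
qed

lemma Lambda_long:
  assumes "\<alpha> \<in> long_roots n \<epsilon>"
  shows "\<Lambda> \<alpha> = Lambda_l \<epsilon> \<Lambda>"
proof -
  obtain \<sigma> \<tau> i j where a: "\<sigma> \<in> signs" "\<tau> \<in> signs" "i \<in> {1..n}" "j \<in> {1..n}" "i \<noteq> j"
      "\<alpha> = \<sigma> *\<^sub>R \<epsilon> i + \<tau> *\<^sub>R \<epsilon> j"
    using assms by (auto simp: long_roots_def)
  note inn = orthonormal_basis_inner[OF on]
  have in_BC: "\<sigma> *\<^sub>R \<epsilon> i + \<tau> *\<^sub>R \<epsilon> j \<in> BC_roots n \<epsilon>"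
    if "\<sigma> \<in> signs" "\<tau> \<in> signs" "i \<in> {1..n}" "j \<in> {1..n}" "i \<noteq> j" for \<sigma> \<tau> i j
    using longI[OF that] by (simp add: BC_roots_def)
  have in_BC1: "\<epsilon> i + \<epsilon> j \<in> BC_roots n \<epsilon>"
    if "i \<in> {1..n}" "j \<in> {1..n}" "i \<noteq> j" for i j
    using in_BC[of 1 1 i j] that by simp
  have flip: "\<Lambda> (1 *\<^sub>R \<epsilon> i + \<tau> *\<^sub>R \<epsilon> j) = \<Lambda> ((-1) *\<^sub>R \<epsilon> i + \<tau> *\<^sub>R \<epsilon> j)"
    if "\<tau> \<in> signs" "i \<in> {1..n}" "j \<in> {1..n}" "i \<noteq> j" for \<tau> i j
  proof (rule Lambda_flip[OF that(2)])
    have "\<epsilon> i \<bullet> \<epsilon> i = 1" "\<epsilon> j \<bullet> \<epsilon> i = 0"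
      using inn[of i i] inn[of j i] that by auto
    then show "(-1) *\<^sub>R \<epsilon> i + \<tau> *\<^sub>R \<epsilon> j = 1 *\<^sub>R \<epsilon> i + \<tau> *\<^sub>R \<epsilon> j -
        (2 * ((1 *\<^sub>R \<epsilon> i + \<tau> *\<^sub>R \<epsilon> j) \<bullet> \<epsilon> i)) *\<^sub>R \<epsilon> i"
      by (simp add: inner_add_left scaleR_2)
  qed (rule in_BC; use that in simp)+
  have drop1: "\<Lambda> (\<sigma> *\<^sub>R \<epsilon> i + \<tau> *\<^sub>R \<epsilon> j) = \<Lambda> (\<epsilon> i + \<tau> *\<^sub>R \<epsilon> j)"
    if "\<sigma> \<in> signs" "\<tau> \<in> signs" "i \<in> {1..n}" "j \<in> {1..n}" "i \<noteq> j" for \<sigma> \<tau> i j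
  proof -
    have "\<sigma> = 1 \<or> \<sigma> = - 1" using that(1) by simp
    then have "\<Lambda> (\<sigma> *\<^sub>R \<epsilon> i + \<tau> *\<^sub>R \<epsilon> j) = \<Lambda> (1 *\<^sub>R \<epsilon> i + \<tau> *\<^sub>R \<epsilon> j)"
      using flip[OF that(2-5)] by metis
    then show ?thesis by (simp only: scaleR_one)
  qed
  have step: "\<Lambda> (\<epsilon> i + \<epsilon> j) = \<Lambda> (\<epsilon> k + \<epsilon> j)"
    if "i \<in> {1..n}" "j \<in> {1..n}" "k \<in> {1..n}" "i \<noteq> j" "k \<noteq> j" for i j k
  proof (cases "i = k")
    case False
    have "\<epsilon> i \<bullet> \<epsilon> i = 1" "\<epsilon> j \<bullet> \<epsilon> i = 0" "\<epsilon> i \<bullet> \<epsilon> k = 0" "\<epsilon> j \<bullet> \<epsilon> k = 0"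
      using inn[of i i] inn[of j i] inn[of i k] inn[of j k] that False by auto
    then show ?thesis
      by (intro Lambda_swap[OF that(1,3) False in_BC1[OF that(1,2,4)] in_BC1[OF that(3,2,5)]])
        (simp add: inner_add_left)
  qed simp
  have "\<Lambda> \<alpha> = \<Lambda> (\<epsilon> i + \<tau> *\<^sub>R \<epsilon> j)" using drop1[OF a(1-5)] a(6) by simp
  also have "\<dots> = \<Lambda> (\<epsilon> j + \<epsilon> i)" 
    using drop1[OF a(2) _ a(4,3) a(5)[symmetric], of 1] by (simp add: add.commute)
  also have "\<dots> = \<Lambda> (\<epsilon> 1 + \<epsilon> 2)"
  proof -
    have n2: "1 \<in> {1..n}" "2 \<in> {1..n}" using a(3-5) by auto
    show ?thesis
    proof (cases "i = 1")
      case True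
      then show ?thesis using step[of j 1 2] n2 a(3-5) by (simp add: add.commute)
    next
      case False
      have "\<Lambda> (\<epsilon> j + \<epsilon> i) = \<Lambda> (\<epsilon> 1 + \<epsilon> i)" using step[of j i 1] n2 a(3-5) False by simp
      also have "\<dots> = \<Lambda> (\<epsilon> 2 + \<epsilon> 1)" using step[of i 1 2] n2 a(3-5) False by (simp add: add.commute)
      finally show ?thesis by (simp add: add.commute)
    qed
  qed
  finally show ?thesis by (simp add: Lambda_l_def)
qed

end

end

theory Submission
  imports Defs
begin

text \<open>
  Write $S \supseteq L \supseteq D$ for the values of \<open>\<Lambda>\<close> on short, long and divisible roots. Then $L$
  is a group, $S$ is a union of $L$-cosets and $2S \subseteq L$. Hence two short roots over distinct
  axes have a real root as their sum exactly when their translation parts lie in the same $L$-coset,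
  and this happens for a closed \<open>\<Psi>\<close> only if the corresponding long root is in its gradient.

  A closed \<open>\<Psi>\<close> is governed by which short and long roots occur in its gradient. If some but not all
  short roots occur, or all short roots but not all long roots occur, then the axes split into two
  blocks without long roots between them, and $S$ splits into the translations allowed on either
  block (one part is empty in the first case); the resulting two-block system is maximal. If all
  short and long roots occur, then after subtracting a linear map the translation parts depend only
  on the length of the root: short roots carry a set $A$, long roots the group $H = A \cap L$, and
  divisible roots are forced to carry the translated $H$ intersected with $D$. So \<open>\<Psi>\<close> and its part
  over $B_n$ determine each other, monotonically, and maximality transfers in both directions.
\<close>

text \<open>The linear map is available because (\<alpha>, y) \<mapsto> (\<alpha>, y + q \<alpha>)
  commutes with sums and with reflections for every linear q. The base points q (\<epsilon> i) must
  be chosen in one common coset of L: S need not be a group, and it is the common coset that puts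
  the sum of two base points into L, where it serves as base point of a long root.

  Divisible roots carry no data of their own because 2 \<epsilon> i = (\<epsilon> i - \<epsilon> j)
  + (\<epsilon> i + \<epsilon> j); this is also the origin of the sum of fibres in the third case.
  In two-block systems long roots carry all of L, so divisible roots carry all of D, as in the
  second case.

  Systems without short roots fit neither shape. The largest of them remains closed when all short
  roots with translations in L are added, and this enlargement is everything exactly when S = L;
  hence the condition for J to be non-empty.\<close>

locale BC_datum =
  fixes n :: nat and \<epsilon> :: "nat \<Rightarrow> 'v::euclidean_space"
    and Y :: "'y::real_vector set" and \<Lambda> :: "'v \<Rightarrow> 'y set"
  assumes n2: "2 \<le> n" and on: "orthonormal_basis n \<epsilon>" and ed: "extension_datum n \<epsilon> Y \<Lambda>"
    and l2: "n = 2 \<Longrightarrow> add_subgroup (Lambda_l \<epsilon> \<Lambda>) Y"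
begin

abbreviation S where "S \<equiv> Lambda_s \<epsilon> \<Lambda>"
abbreviation L where "L \<equiv> Lambda_l \<epsilon> \<Lambda>"
abbreviation D where "D \<equiv> Lambda_d \<epsilon> \<Lambda>"
abbreviation BC where "BC \<equiv> BC_roots n \<epsilon>"
abbreviation RR where "RR \<equiv> real_roots n \<epsilon> \<Lambda>"
abbreviation BR where "BR \<equiv> B_real_roots n \<epsilon> \<Lambda>"

text \<open>The signed index \<open>k\<close> encodes \<open>sgn k\<close> times the basis vector with index \<open>\<bar>k\<bar>\<close>, so that long and
  divisible roots are the sums \<open>u k + u m\<close> with \<open>m \<noteq> - k\<close>, and reflections permute signed indices.\<close>

definition E :: "int set" where "E = {k. k \<noteq> 0 \<and> \<bar>k\<bar> \<le> int n}"

definition u :: "int \<Rightarrow> 'v" where "u k = of_int (sgn k) *\<^sub>R \<epsilon> (nat \<bar>k\<bar>)"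

lemma u_minus [simp]: "u (- k) = - u k"
  by (simp add: u_def sgn_minus)

lemma E_minus [simp]: "- k \<in> E \<longleftrightarrow> k \<in> E"
  by (auto simp: E_def)

lemma E_nonzero: "k \<in> E \<Longrightarrow> k \<noteq> 0" "k \<in> E \<Longrightarrow> - k \<noteq> k" "k \<in> E \<Longrightarrow> k \<noteq> - k"
  by (auto simp: E_def)

lemma E_nat: "i \<in> {1..n} \<Longrightarrow> int i \<in> E" "i \<in> {1..n} \<Longrightarrow> u (int i) = \<epsilon> i"
  by (auto simp: E_def u_def)

lemma u_inner:
  assumes "k \<in> E" "m \<in> E"
  shows "u k \<bullet> u m = (if k = m then 1 else if k = - m then - 1 else 0)"
proof -
  have "nat \<bar>k\<bar> \<in> {1..n}" "nat \<bar>m\<bar> \<in> {1..n}" using assms by (auto simp: E_def)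
  from orthonormal_basis_inner[OF on this] have
    "\<epsilon> (nat \<bar>k\<bar>) \<bullet> \<epsilon> (nat \<bar>m\<bar>) = (if \<bar>k\<bar> = \<bar>m\<bar> then 1 else 0)"
    by (auto simp: eq_nat_nat_iff)
  then show ?thesis using assms by (auto simp: u_def E_def sgn_if abs_if split: if_splits)
qed

lemma signed_index:
  assumes "\<sigma> \<in> signs" "i \<in> {1..n}"
  obtains k where "k \<in> E" "\<sigma> *\<^sub>R \<epsilon> i = u k" "nat \<bar>k\<bar> = i"
proof -
  have "int i \<in> E" "- int i \<in> E" using E_nat(1)[OF assms(2)] by auto
  moreover have "\<sigma> *\<^sub>R \<epsilon> i = u (int i) \<or> \<sigma> *\<^sub>R \<epsilon> i = u (- int i)"
    using assms E_nat(2)[OF assms(2)] by auto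
  ultimately show ?thesis using that[of "int i"] that[of "- int i"] by auto
qed

lemma index_signed:
  assumes "k \<in> E"
  obtains \<sigma> i where "\<sigma> \<in> signs" "i \<in> {1..n}" "u k = \<sigma> *\<^sub>R \<epsilon> i" "i = nat \<bar>k\<bar>"
proof (rule that)
  show "u k = of_int (sgn k) *\<^sub>R \<epsilon> (nat \<bar>k\<bar>)" by (rule u_def)
qed (use assms in \<open>auto simp: E_def sgn_if\<close>)

lemma nat_abs_eq_iff: "nat \<bar>k\<bar> = nat \<bar>m\<bar> \<longleftrightarrow> k = m \<or> k = - m" for k m :: int
  by (auto simp: abs_if)

section \<open>Short, long and divisible roots in signed indices\<close>

lemma short_iff: "\<alpha> \<in> short_roots n \<epsilon> \<longleftrightarrow> (\<exists>k\<in>E. \<alpha> = u k)"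
proof
  assume "\<alpha> \<in> short_roots n \<epsilon>"
  then obtain \<sigma> i where "\<sigma> \<in> signs" "i \<in> {1..n}" "\<alpha> = \<sigma> *\<^sub>R \<epsilon> i"
    unfolding short_roots_def by blast
  then show "\<exists>k\<in>E. \<alpha> = u k" by (metis signed_index)
next
  assume "\<exists>k\<in>E. \<alpha> = u k"
  then show "\<alpha> \<in> short_roots n \<epsilon>" by (metis index_signed shortI[OF on ed])
qed

lemma long_iff:
  "\<alpha> \<in> long_roots n \<epsilon> \<longleftrightarrow> (\<exists>k\<in>E. \<exists>m\<in>E. k \<noteq> m \<and> k \<noteq> - m \<and> \<alpha> = u k + u m)"
proof
  assume "\<alpha> \<in> long_roots n \<epsilon>"
  then obtain \<sigma> \<tau> i j where a: "\<sigma> \<in> signs" "\<tau> \<in> signs" "i \<in> {1..n}" "j \<in> {1..n}" "i \<noteq> j"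
      "\<alpha> = \<sigma> *\<^sub>R \<epsilon> i + \<tau> *\<^sub>R \<epsilon> j"
    unfolding long_roots_def by blast
  obtain k where "k \<in> E" "\<sigma> *\<^sub>R \<epsilon> i = u k" "nat \<bar>k\<bar> = i" using signed_index a(1,3) .
  moreover obtain m where "m \<in> E" "\<tau> *\<^sub>R \<epsilon> j = u m" "nat \<bar>m\<bar> = j" using signed_index a(2,4) .
  ultimately show "\<exists>k\<in>E. \<exists>m\<in>E. k \<noteq> m \<and> k \<noteq> - m \<and> \<alpha> = u k + u m"
    using a(5,6) nat_abs_eq_iff by metis
next
  assume "\<exists>k\<in>E. \<exists>m\<in>E. k \<noteq> m \<and> k \<noteq> - m \<and> \<alpha> = u k + u m"
  then obtain k m where a: "k \<in> E" "m \<in> E" "k \<noteq> m" "k \<noteq> - m" "\<alpha> = u k + u m" by blast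
  obtain \<sigma> i where "\<sigma> \<in> signs" "i \<in> {1..n}" "u k = \<sigma> *\<^sub>R \<epsilon> i" "i = nat \<bar>k\<bar>"
    using index_signed a(1) .
  moreover obtain \<tau> j where "\<tau> \<in> signs" "j \<in> {1..n}" "u m = \<tau> *\<^sub>R \<epsilon> j" "j = nat \<bar>m\<bar>"
    using index_signed a(2) .
  ultimately show "\<alpha> \<in> long_roots n \<epsilon>"
    using longI[OF on ed, of \<sigma> \<tau> i j] a nat_abs_eq_iff by metis
qed

lemma divisible_iff: "\<alpha> \<in> divisible_roots n \<epsilon> \<longleftrightarrow> (\<exists>k\<in>E. \<alpha> = u k + u k)"
proof
  assume "\<alpha> \<in> divisible_roots n \<epsilon>"
  then obtain \<sigma> i where a: "\<sigma> \<in> signs" "i \<in> {1..n}" "\<alpha> = \<sigma> *\<^sub>R (2 *\<^sub>R \<epsilon> i)"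
    unfolding divisible_roots_def by blast
  obtain k where "k \<in> E" "\<sigma> *\<^sub>R \<epsilon> i = u k" "nat \<bar>k\<bar> = i" using signed_index a(1,2) .
  moreover have "\<alpha> = \<sigma> *\<^sub>R \<epsilon> i + \<sigma> *\<^sub>R \<epsilon> i" using a(3) by (simp add: scaleR_2 scaleR_right_distrib)
  ultimately show "\<exists>k\<in>E. \<alpha> = u k + u k" by auto
next
  assume "\<exists>k\<in>E. \<alpha> = u k + u k"
  then obtain k where a: "k \<in> E" "\<alpha> = u k + u k" by blast
  obtain \<sigma> i where i: "\<sigma> \<in> signs" "i \<in> {1..n}" "u k = \<sigma> *\<^sub>R \<epsilon> i" "i = nat \<bar>k\<bar>"
    using index_signed a(1) .
  have "\<alpha> = \<sigma> *\<^sub>R (2 *\<^sub>R \<epsilon> i)" using a i by (simp add: scaleR_2 scaleR_right_distrib)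
  then show "\<alpha> \<in> divisible_roots n \<epsilon>" using divisibleI[OF on ed i(1,2)] by simp
qed

lemma B_iff: "\<alpha> \<in> B_roots n \<epsilon> \<longleftrightarrow>
    (\<exists>k\<in>E. \<alpha> = u k) \<or> (\<exists>k\<in>E. \<exists>m\<in>E. k \<noteq> m \<and> k \<noteq> - m \<and> \<alpha> = u k + u m)"
  by (simp add: B_roots_def short_iff long_iff)

lemma BC_iff: "\<alpha> \<in> BC \<longleftrightarrow>
    (\<exists>k\<in>E. \<alpha> = u k) \<or> (\<exists>k\<in>E. \<exists>m\<in>E. k \<noteq> - m \<and> \<alpha> = u k + u m)"
proof
  assume "\<alpha> \<in> BC"
  then show "(\<exists>k\<in>E. \<alpha> = u k) \<or> (\<exists>k\<in>E. \<exists>m\<in>E. k \<noteq> - m \<and> \<alpha> = u k + u m)"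
    unfolding BC_roots_def Un_iff short_iff long_iff divisible_iff using E_nonzero(3) by blast
next
  assume "(\<exists>k\<in>E. \<alpha> = u k) \<or> (\<exists>k\<in>E. \<exists>m\<in>E. k \<noteq> - m \<and> \<alpha> = u k + u m)"
  then show "\<alpha> \<in> BC"
    unfolding BC_roots_def Un_iff short_iff long_iff divisible_iff by metis
qed

lemma BC_cases:
  assumes "\<alpha> \<in> BC"
  obtains (short) k where "k \<in> E" "\<alpha> = u k"
    | (long) k m where "k \<in> E" "m \<in> E" "k \<noteq> m" "k \<noteq> - m" "\<alpha> = u k + u m"
    | (div) k where "k \<in> E" "\<alpha> = u k + u k"
  using assms unfolding BC_iff by blast

lemma BC_norm:
  assumes "\<alpha> \<in> BC"
  shows "\<alpha> \<bullet> \<alpha> = 1 \<and> \<alpha> \<in> short_roots n \<epsilon> \<or> \<alpha> \<bullet> \<alpha> = 2 \<and> \<alpha> \<in> long_roots n \<epsilon> \<or>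
    \<alpha> \<bullet> \<alpha> = 4 \<and> \<alpha> \<in> divisible_roots n \<epsilon>"
  using assms
proof (cases rule: BC_cases)
  case (short k) then show ?thesis by (auto simp: u_inner short_iff)
next
  case (long k m)
  have "u k \<bullet> u k = 1" "u m \<bullet> u m = 1" "u k \<bullet> u m = 0" "u m \<bullet> u k = 0"
    using long by (auto simp: u_inner)
  then have "\<alpha> \<bullet> \<alpha> = 2" by (simp add: long inner_simps)
  then show ?thesis using long by (auto simp: long_iff)
next
  case (div k) then show ?thesis by (auto simp: u_inner inner_simps divisible_iff)
qed

lemma root_kinds_disjoint:
  "short_roots n \<epsilon> \<inter> long_roots n \<epsilon> = {}"
  "short_roots n \<epsilon> \<inter> divisible_roots n \<epsilon> = {}"
  "long_roots n \<epsilon> \<inter> divisible_roots n \<epsilon> = {}"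
  "0 \<notin> BC"
proof -
  have s: "\<alpha> \<bullet> \<alpha> = 1" if "\<alpha> \<in> short_roots n \<epsilon>" for \<alpha>
    using that by (auto simp: short_iff u_inner)
  have d: "\<alpha> \<bullet> \<alpha> = 4" if "\<alpha> \<in> divisible_roots n \<epsilon>" for \<alpha>
    using that by (auto simp: divisible_iff u_inner inner_simps)
  have l: "\<alpha> \<bullet> \<alpha> = 2" if \<alpha>: "\<alpha> \<in> long_roots n \<epsilon>" for \<alpha>
  proof -
    obtain k m where long: "k \<in> E" "m \<in> E" "k \<noteq> m" "k \<noteq> - m" "\<alpha> = u k + u m"
      using \<alpha> unfolding long_iff by blast
    have "u k \<bullet> u k = 1" "u m \<bullet> u m = 1" "u k \<bullet> u m = 0" "u m \<bullet> u k = 0"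
      using long by (auto simp: u_inner)
    then show ?thesis by (simp add: long inner_simps)
  qed
  show "short_roots n \<epsilon> \<inter> long_roots n \<epsilon> = {}"
  "short_roots n \<epsilon> \<inter> divisible_roots n \<epsilon> = {}"
  "long_roots n \<epsilon> \<inter> divisible_roots n \<epsilon> = {}"
    using s l d by fastforce+
  show "0 \<notin> BC" using BC_norm[of 0] by auto
qed

section \<open>Uniqueness of indices, and which sums of roots are roots\<close>

lemma u_eq_iff: "k \<in> E \<Longrightarrow> m \<in> E \<Longrightarrow> u k = u m \<longleftrightarrow> k = m"
proof
  assume k: "k \<in> E" "m \<in> E" "u k = u m"
  then have "u k \<bullet> u m = 1" using u_inner[of m m] by simp
  then show "k = m" using k(1,2) u_inner[of k m] by (auto split: if_splits)
qed simp

text \<open>Pairing the left side with \<open>u j\<close> gives at least 1, since \<open>u k\<close>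
  is not opposite to \<open>u j\<close>; on the right this forces \<open>m\<close> or
  \<open>q\<close> to equal \<open>j\<close>. Hence conditions on long and divisible roots may be
  stated through their indices.\<close>

lemma u_sum_eq:
  assumes E: "j \<in> E" "k \<in> E" "m \<in> E" "q \<in> E" and "u j + u k = u m + u q" and "j \<noteq> - k"
  shows "j = m \<and> k = q \<or> j = q \<and> k = m"
proof -
  have "(u j + u k) \<bullet> u j \<ge> 1" "(u j + u k) \<bullet> u k \<ge> 1"
    using E assms(6) by (auto simp: u_inner inner_simps)
  then have a: "u m \<bullet> u j + u q \<bullet> u j \<ge> 1" "u m \<bullet> u k + u q \<bullet> u k \<ge> 1"
    using assms(5) by (auto simp: inner_simps)
  from a(1) have "j = m \<or> j = q" using E by (auto simp: u_inner split: if_splits)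
  then show ?thesis
  proof
    assume "j = m" then show ?thesis using assms(5) E u_eq_iff by auto
  next
    assume "j = q"
    then have "u k = u m" using assms(5) by simp
    then show ?thesis using \<open>j = q\<close> E u_eq_iff by auto
  qed
qed

text \<open>Without an opposite pair all inner products are natural numbers, so the squared norm is
  odd and at least 3, while roots have squared norm 1, 2 or 4.\<close>

lemma root_sum_short:
  assumes E: "j \<in> E" "k \<in> E" "m \<in> E" and "k \<noteq> - m" and "u j + (u k + u m) \<in> BC"
  shows "j = - k \<or> j = - m"
proof (rule ccontr)
  assume no: "\<not> ?thesis"
  let ?v = "u j + (u k + u m)"
  have i: "\<exists>z::nat. u a \<bullet> u b = z" if "a \<in> E" "b \<in> E" "a \<noteq> - b" for a b
    using that by (intro exI[of _ "if a = b then 1 else 0"]) (auto simp: u_inner)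
  obtain x y z :: nat where "u j \<bullet> u k = x" "u j \<bullet> u m = y" "u k \<bullet> u m = z"
    using i[of j k] i[of j m] i[of k m] assms no by auto
  then have "?v \<bullet> ?v = real (3 + 2 * (x + y + z))"
    using E u_inner[of j j] u_inner[of k k] u_inner[of m m]
    by (simp add: inner_simps inner_commute algebra_simps)
  moreover have "?v \<bullet> ?v = real 1 \<or> ?v \<bullet> ?v = real 2 \<or> ?v \<bullet> ?v = real 4" using BC_norm[OF assms(5)] by auto
  ultimately have "3 + 2 * (x + y + z) = 1 \<or> 3 + 2 * (x + y + z) = 2 \<or> 3 + 2 * (x + y + z) = 4"
    by (metis of_nat_eq_iff)
  then show False by presburger
qed

text \<open>Without an opposite pair the squared norm is at least 4, so the sum is a divisible root
  and the four unit vectors are orthogonal, hence distinct. Against its own axis vector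
  \<open>u a\<close> a divisible root has inner product 2, but at most one of four distinct indices
  equals \<open>a\<close>.\<close>

lemma root_sum_long:
  assumes E: "j \<in> E" "k \<in> E" "m \<in> E" "q \<in> E" and "j \<noteq> - k" "m \<noteq> - q"
    and BC: "(u j + u k) + (u m + u q) \<in> BC"
  shows "j = - m \<or> j = - q \<or> k = - m \<or> k = - q"
proof (rule ccontr)
  assume no: "\<not> ?thesis"
  let ?v = "(u j + u k) + (u m + u q)"
  have i: "u a \<bullet> u b \<ge> 0" if "a \<in> E" "b \<in> E" "a \<noteq> - b" for a b
    using that by (auto simp: u_inner)
  have nn: "u j \<bullet> u k \<ge> 0" "u j \<bullet> u m \<ge> 0" "u j \<bullet> u q \<ge> 0" "u k \<bullet> u m \<ge> 0" "u k \<bullet> u q \<ge> 0" "u m \<bullet> u q \<ge> 0"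
    by (rule i; use assms no in auto)+
  have v: "?v \<bullet> ?v = 4 + 2 * (u j \<bullet> u k + u j \<bullet> u m + u j \<bullet> u q + u k \<bullet> u m + u k \<bullet> u q + u m \<bullet> u q)"
    using E u_inner[of j j] u_inner[of k k] u_inner[of m m] u_inner[of q q]
    by (simp add: inner_simps inner_commute algebra_simps)
  then have d: "?v \<bullet> ?v = 4" "?v \<in> divisible_roots n \<epsilon>" using nn BC_norm[OF BC] by auto
  then have z: "u j \<bullet> u k = 0" "u j \<bullet> u m = 0" "u j \<bullet> u q = 0" "u k \<bullet> u m = 0" "u k \<bullet> u q = 0" "u m \<bullet> u q = 0"
    using v nn by auto
  then have ne: "distinct [j, k, m, q]" using E by (auto simp: u_inner)
  obtain a where a: "a \<in> E" "?v = u a + u a" using d(2) by (auto simp: divisible_iff)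
  have "?v \<bullet> u a = 2" using a u_inner[of a a] by (simp add: inner_simps)
  then have "u j \<bullet> u a + u k \<bullet> u a + u m \<bullet> u a + u q \<bullet> u a = 2" by (simp add: inner_simps)
  moreover have "u x \<bullet> u a \<le> (if x = a then 1 else 0)" if "x \<in> E" for x
    using that a(1) by (simp add: u_inner)
  then have "u j \<bullet> u a + u k \<bullet> u a + u m \<bullet> u a + u q \<bullet> u a \<le>
    (if j = a then 1 else 0) + (if k = a then 1 else 0) + (if m = a then 1 else 0) + (if q = a then 1 else 0)"
    using E by (intro add_mono)
  ultimately show False using ne by (auto split: if_splits)
qed

section \<open>Membership rules and reflections in signed indices\<close>

lemma mem_kinds:
  "k \<in> E \<Longrightarrow> u k \<in> short_roots n \<epsilon>"
  "k \<in> E \<Longrightarrow> m \<in> E \<Longrightarrow> k \<noteq> m \<Longrightarrow> k \<noteq> - m \<Longrightarrow> u k + u m \<in> long_roots n \<epsilon>"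
  "k \<in> E \<Longrightarrow> u k + u k \<in> divisible_roots n \<epsilon>"
  unfolding short_iff long_iff divisible_iff by metis+

lemma Lambda_u [simp]:
  "k \<in> E \<Longrightarrow> \<Lambda> (u k) = S"
  "k \<in> E \<Longrightarrow> m \<in> E \<Longrightarrow> k \<noteq> m \<Longrightarrow> k \<noteq> - m \<Longrightarrow> \<Lambda> (u k + u m) = L"
  "k \<in> E \<Longrightarrow> \<Lambda> (u k + u k) = D"
  by (rule Lambda_short[OF on ed mem_kinds(1)] Lambda_long[OF on ed mem_kinds(2)]
      Lambda_divisible[OF on ed mem_kinds(3)]; assumption)+

lemma mem_BC [simp]:
  "k \<in> E \<Longrightarrow> u k \<in> BC"
  "k \<in> E \<Longrightarrow> m \<in> E \<Longrightarrow> k \<noteq> - m \<Longrightarrow> u k + u m \<in> BC"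
  unfolding BC_iff by metis+

lemma mem_B [simp]:
  "k \<in> E \<Longrightarrow> u k \<in> B_roots n \<epsilon>"
  "k \<in> E \<Longrightarrow> m \<in> E \<Longrightarrow> k \<noteq> m \<Longrightarrow> k \<noteq> - m \<Longrightarrow> u k + u m \<in> B_roots n \<epsilon>"
  unfolding B_iff by metis+

lemma div_not_B [simp]: "k \<in> E \<Longrightarrow> u k + u k \<notin> B_roots n \<epsilon>"
  using root_kinds_disjoint(2,3) mem_kinds(3)[of k] unfolding B_roots_def by blast

text \<open>The reflection in \<open>u e + u g\<close> sends \<open>e\<close> to \<open>- g\<close>
  and \<open>g\<close> to \<open>- e\<close>. For \<open>e = g\<close> it becomes the sign change of
  one axis, so the same formula serves \<open>u e\<close> and \<open>u e + u e\<close>.\<close>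

definition refl_perm :: "int \<Rightarrow> int \<Rightarrow> int \<Rightarrow> int" where
  "refl_perm e g f = (if f = e then - g else if f = - e then g
     else if f = g then - e else if f = - g then e else f)"

lemma refl_short:
  assumes "e \<in> E" "f \<in> E"
  shows "refl_affine (u e, z) (u f, y) = (u (refl_perm e e f), y - (2 * (u f \<bullet> u e)) *\<^sub>R z)"
    "refl_affine (u e + u e, z) (u f, y) = (u (refl_perm e e f), y - (u f \<bullet> u e) *\<^sub>R z)"
proof -
  have e: "u e \<bullet> u e = 1" using u_inner[OF assms(1,1)] by simp
  have r: "u f - (2 * (u f \<bullet> u e)) *\<^sub>R u e = u (refl_perm e e f)"
    using u_inner[OF assms(2,1)] E_nonzero(1)[OF assms(1)] by (simp add: refl_perm_def scaleR_2)
  have "u f \<bullet> coroot (u e) = 2 * (u f \<bullet> u e)" using e by (simp add: coroot_def)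
  then show "refl_affine (u e, z) (u f, y) = (u (refl_perm e e f), y - (2 * (u f \<bullet> u e)) *\<^sub>R z)"
    using r by (simp add: refl_affine_def refl_root_def)
  have "u f \<bullet> coroot (u e + u e) = u f \<bullet> u e" using e by (simp add: coroot_def inner_simps)
  moreover have "u f - (u f \<bullet> u e) *\<^sub>R (u e + u e) = u (refl_perm e e f)"
    by (simp flip: r add: scaleR_2[symmetric])
  ultimately show "refl_affine (u e + u e, z) (u f, y) = (u (refl_perm e e f), y - (u f \<bullet> u e) *\<^sub>R z)"
    by (simp add: refl_affine_def refl_root_def)
qed

lemma refl_long:
  assumes "e \<in> E" "g \<in> E" "f \<in> E" "e \<noteq> g" "e \<noteq> - g"
  shows "refl_affine (u e + u g, z) (u f, y) =
    (u (refl_perm e g f), y - (u f \<bullet> u e + u f \<bullet> u g) *\<^sub>R z)"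
proof -
  have ne: "g \<noteq> - e" "g \<noteq> e" "- e \<noteq> g" "- g \<noteq> e" "- e \<noteq> e" "- g \<noteq> g"
    using assms E_nonzero by force+
  have "(u e + u g) \<bullet> (u e + u g) = 2"
    using assms ne u_inner[of e e] u_inner[of g g] u_inner[of e g] u_inner[of g e] by (simp add: inner_simps)
  then have "u f \<bullet> coroot (u e + u g) = u f \<bullet> u e + u f \<bullet> u g" by (simp add: coroot_def inner_simps)
  moreover have "u f - (u f \<bullet> u e + u f \<bullet> u g) *\<^sub>R (u e + u g) = u (refl_perm e g f)"
    using assms ne u_inner[of f e] u_inner[of f g] by (simp add: refl_perm_def)
  ultimately show ?thesis by (simp add: refl_affine_def refl_root_def)
qed

text \<open>Injectivity is phrased with opposite indices because \<open>k \<noteq> - m\<close> is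
  the condition under which \<open>u k + u m\<close> is a root; this form shows that reflections
  preserve it.\<close>

lemma refl_perm:
  assumes "e \<in> E" "g \<in> E" "e \<noteq> - g" "f \<in> E"
  shows "refl_perm e g f \<in> E" "refl_perm e g f = - refl_perm e g f' \<Longrightarrow> f' \<in> E \<Longrightarrow> f = - f'"
proof -
  show "refl_perm e g f \<in> E" using assms by (simp add: refl_perm_def)
  assume "refl_perm e g f = - refl_perm e g f'" "f' \<in> E"
  moreover have "e \<noteq> 0" "g \<noteq> 0" using assms E_nonzero by auto
  ultimately show "f = - f'" using assms(3) unfolding refl_perm_def by (smt (verit))
qed

lemma refl_affine_add: "refl_affine a (b + b') = refl_affine a b + refl_affine a b'"
  by (cases a; cases b; cases b')
    (simp add: refl_affine_def refl_root_def inner_add_left scaleR_left_distrib)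

lemma refl_affine_self: "fst a \<noteq> 0 \<Longrightarrow> refl_affine a a = - a"
  by (cases a) (simp add: refl_affine_def refl_root_def coroot_def scaleR_2)

lemma mem_RR [simp]:
  "k \<in> E \<Longrightarrow> (u k, y) \<in> RR \<longleftrightarrow> y \<in> S"
  "k \<in> E \<Longrightarrow> m \<in> E \<Longrightarrow> k \<noteq> m \<Longrightarrow> k \<noteq> - m \<Longrightarrow> (u k + u m, y) \<in> RR \<longleftrightarrow> y \<in> L"
  "k \<in> E \<Longrightarrow> (u k + u k, y) \<in> RR \<longleftrightarrow> y \<in> D"
  using E_nonzero(3)[of k] by (simp_all add: real_roots_def)

lemma mem_BR [simp]:
  "k \<in> E \<Longrightarrow> (u k, y) \<in> BR \<longleftrightarrow> y \<in> S"
  "k \<in> E \<Longrightarrow> m \<in> E \<Longrightarrow> k \<noteq> m \<Longrightarrow> k \<noteq> - m \<Longrightarrow> (u k + u m, y) \<in> BR \<longleftrightarrow> y \<in> L"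
  "k \<in> E \<Longrightarrow> (u k + u k, y) \<notin> BR"
  by (simp_all add: B_real_roots_def)

text \<open>One description for all three kinds of roots, so that later arguments about reflections
  need no case split on the reflecting root; \<open>e = g\<close> covers the short and the divisible
  ones.\<close>

lemma refl_root_perm:
  assumes "\<alpha> \<in> BC"
  obtains e g where "e \<in> E" "g \<in> E" "e \<noteq> - g" "\<alpha> = u e \<and> e = g \<or> \<alpha> = u e + u g"
    "\<And>f (z::'y) y. f \<in> E \<Longrightarrow>
      refl_affine (\<alpha>, z) (u f, y) = (u (refl_perm e g f), y - (u f \<bullet> coroot \<alpha>) *\<^sub>R z)"
proof -
  have fst: "refl_affine (\<alpha>, z) (u f, y) = (u p, y - (u f \<bullet> coroot \<alpha>) *\<^sub>R z)"
    if "refl_affine (\<alpha>, z) (u f, y) = (u p, x)" for \<alpha> z f y p x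
    using that by (simp add: refl_affine_def)
  from assms show ?thesis
  proof (cases rule: BC_cases)
    case (short k)
    show ?thesis
    proof (rule that[of k k])
      show "refl_affine (\<alpha>, z) (u f, y) = (u (refl_perm k k f), y - (u f \<bullet> coroot \<alpha>) *\<^sub>R z)"
        if "f \<in> E" for f z y
        unfolding short(2) by (rule fst[OF refl_short(1)[OF short(1) that]])
    qed (use short E_nonzero in auto)
  next
    case (long k m)
    show ?thesis
    proof (rule that[of k m])
      show "refl_affine (\<alpha>, z) (u f, y) = (u (refl_perm k m f), y - (u f \<bullet> coroot \<alpha>) *\<^sub>R z)"
        if "f \<in> E" for f z y
        unfolding long(5) by (rule fst[OF refl_long[OF long(1,2) that long(3,4)]])
    qed (use long in auto)
  next
    case (div k)
    show ?thesis
    proof (rule that[of k k])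
      show "refl_affine (\<alpha>, z) (u f, y) = (u (refl_perm k k f), y - (u f \<bullet> coroot \<alpha>) *\<^sub>R z)"
        if "f \<in> E" for f z y
        unfolding div(2) by (rule fst[OF refl_short(2)[OF div(1) that]])
    qed (use div E_nonzero in auto)
  qed
qed

lemma refl_root_add: "refl_root \<alpha> (v + w) = refl_root \<alpha> v + refl_root \<alpha> w"
  by (simp add: refl_root_def inner_add_left scaleR_left_distrib)

lemma refl_root_BC:
  assumes "\<alpha> \<in> BC" "\<beta> \<in> BC"
  shows "refl_root \<alpha> \<beta> \<in> BC"
    "\<beta> \<in> B_roots n \<epsilon> \<Longrightarrow> refl_root \<alpha> \<beta> \<in> B_roots n \<epsilon>"
proof -
  obtain e g where eg: "e \<in> E" "g \<in> E" "e \<noteq> - g" and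
    r: "\<And>f (z::'y) y. f \<in> E \<Longrightarrow>
      refl_affine (\<alpha>, z) (u f, y) = (u (refl_perm e g f), y - (u f \<bullet> coroot \<alpha>) *\<^sub>R z)"
    using refl_root_perm[OF assms(1)] by metis
  have r': "refl_root \<alpha> (u f) = u (refl_perm e g f)" if "f \<in> E" for f
    using r[OF that] by (simp add: refl_affine_def)
  note p = refl_perm[OF eg]
  have inj: "refl_perm e g k \<noteq> refl_perm e g m" if "k \<noteq> m" "k \<in> E" "m \<in> E" for k m
    using p(2)[of k "- m"] that eg E_nonzero[of m] E_nonzero[of g] E_nonzero[of e]
    by (smt (verit) E_minus refl_perm_def)
  show "refl_root \<alpha> \<beta> \<in> BC" using assms(2)
    unfolding BC_iff by (elim disjE bexE conjE) (metis r' refl_root_add p)+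
  show "refl_root \<alpha> \<beta> \<in> B_roots n \<epsilon>" if "\<beta> \<in> B_roots n \<epsilon>"
    using that unfolding B_iff by (elim disjE bexE conjE) (metis r' refl_root_add p inj)+
qed

lemma RR_refl:
  assumes "a \<in> RR" "b \<in> RR"
  shows "refl_affine a b \<in> RR"
proof -
  obtain \<alpha> z \<beta> y where ab: "a = (\<alpha>, z)" "b = (\<beta>, y)" by fastforce
  with assms have m: "\<alpha> \<in> BC" "z \<in> \<Lambda> \<alpha>" "\<beta> \<in> BC" "y \<in> \<Lambda> \<beta>" by (auto simp: real_roots_def)
  then have "{y - (\<beta> \<bullet> coroot \<alpha>) *\<^sub>R z | y z. y \<in> \<Lambda> \<beta> \<and> z \<in> \<Lambda> \<alpha>} \<subseteq> \<Lambda> (refl_root \<alpha> \<beta>)"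
    using ed unfolding extension_datum_def by blast
  then show ?thesis using m refl_root_BC(1)[of \<alpha> \<beta>]
    unfolding ab by (auto simp: real_roots_def refl_affine_def)
qed

lemma BR_refl:
  assumes "a \<in> BR" "b \<in> BR"
  shows "refl_affine a b \<in> BR"
proof -
  have "a \<in> RR" "b \<in> RR" "fst b \<in> B_roots n \<epsilon>"
    using assms by (auto simp: B_real_roots_def real_roots_def B_roots_def BC_roots_def)
  moreover have "fst a \<in> BC" "fst b \<in> BC" using calculation by (auto simp: real_roots_def)
  ultimately show ?thesis using RR_refl[of a b] refl_root_BC(2)[of "fst a" "fst b"]
    by (auto simp: real_roots_def B_real_roots_def refl_affine_def)
qed

section \<open>Arithmetic of the translation sets \<open>S\<close>, \<open>L\<close> and
  \<open>D\<close>\<close>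

lemma E12 [simp]: "1 \<in> E" "2 \<in> E" "3 \<le> n \<Longrightarrow> 3 \<in> E"
  using n2 by (auto simp: E_def)

lemma S_0 [simp]: "0 \<in> S" and L_0 [simp]: "0 \<in> L"
proof -
  have "0 \<in> \<Lambda> (u 1)" "0 \<in> \<Lambda> (u 1 + u 2)"
    using ed mem_kinds(1)[of 1] mem_kinds(2)[of 1 2] unfolding extension_datum_def
    by (simp_all del: Lambda_u)
  then show "0 \<in> S" "0 \<in> L" by simp_all
qed

text \<open>Reflecting \<open>u 1\<close> in \<open>u 1 + u 2\<close> gives \<open>u (- 2)\<close>
  with translation \<open>y - z\<close>.\<close>

lemma S_diff_L: "y \<in> S \<Longrightarrow> z \<in> L \<Longrightarrow> y - z \<in> S"
  using RR_refl[of "(u 1 + u 2, z)" "(u 1, y)"] refl_long[of 1 2 1 z y] mem_RR(1)[of "-2"]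
  by (simp add: refl_perm_def u_inner del: u_minus)

text \<open>The long root is split as (u 1, y) + (u 2, 0); the reflection in \<open>u 1\<close>
  changes only the first summand. The next lemma does the same with the divisible root over that
  axis, where the coefficient is 1 instead of 2.\<close>

lemma L_diff_2S: "y \<in> L \<Longrightarrow> z \<in> S \<Longrightarrow> y - 2 *\<^sub>R z \<in> L"
  using RR_refl[of "(u 1, z)" "(u 1 + u 2, y)"] refl_affine_add[of "(u 1, z)" "(u 1, y)" "(u 2, 0)"]
    refl_short(1)[of 1 1 z y] refl_short(1)[of 1 2 z 0] mem_RR(2)[of "- 1" 2]
  by (simp add: refl_perm_def u_inner del: u_minus)

lemma L_diff_D: "y \<in> L \<Longrightarrow> z \<in> D \<Longrightarrow> y - z \<in> L"
  using RR_refl[of "(u 1 + u 1, z)" "(u 1 + u 2, y)"]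
    refl_affine_add[of "(u 1 + u 1, z)" "(u 1, y)" "(u 2, 0)"]
    refl_short(2)[of 1 1 z y] refl_short(2)[of 1 2 z 0] mem_RR(2)[of "- 1" 2]
  by (simp add: refl_perm_def u_inner del: u_minus)

text \<open>With a third axis, two long roots sharing one axis have coefficient 1, so reflecting one
  in the other subtracts translations. For n = 2 distinct non-opposite long roots are orthogonal,
  and the group property is the standing assumption.\<close>

lemma L_diff: "y \<in> L \<Longrightarrow> z \<in> L \<Longrightarrow> y - z \<in> L"
proof (cases "n = 2")
  case True
  then show "y \<in> L \<Longrightarrow> z \<in> L \<Longrightarrow> y - z \<in> L"
    using l2 unfolding add_subgroup_def by (metis diff_conv_add_uminus)
next
  case False
  then have "3 \<in> E" using n2 by simp
  then show "y \<in> L \<Longrightarrow> z \<in> L \<Longrightarrow> y - z \<in> L"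
    using RR_refl[of "(u 1 + u 2, z)" "(u 1 + u 3, y)"]
    refl_affine_add[of "(u 1 + u 2, z)" "(u 1, y)" "(u 3, 0)"]
    refl_long[of 1 2 1 z y] refl_long[of 1 2 3 z 0] mem_RR(2)[of "- 2" 3]
  by (simp add: refl_perm_def u_inner del: u_minus)
qed

lemma L_neg: "y \<in> L \<Longrightarrow> - y \<in> L"
  using L_diff[of 0 y] by simp

lemma L_add: "y \<in> L \<Longrightarrow> z \<in> L \<Longrightarrow> y + z \<in> L"
  using L_diff[of y "- z"] L_neg by simp

lemma S_add_L: "y \<in> S \<Longrightarrow> z \<in> L \<Longrightarrow> y + z \<in> S"
  using S_diff_L[of y "- z"] L_neg by simp

lemma L_sub_S: "y \<in> L \<Longrightarrow> y \<in> S"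
  using S_add_L[of 0 y] by simp

lemma D_sub_L: "y \<in> D \<Longrightarrow> y \<in> L"
  using L_diff_D[of 0 y] L_neg[of "- y"] by simp

lemma two_S: "y \<in> S \<Longrightarrow> y + y \<in> L"
  using L_diff_2S[of 0 y] L_neg[of "- (2 *\<^sub>R y)"] by (simp add: scaleR_2)

lemma S_neg: "y \<in> S \<Longrightarrow> - y \<in> S"
  using S_diff_L[OF _ two_S[of y], of y] by simp

subsection \<open>Explicit closed subsystems\<close>

text \<open>Properness and non-emptiness are left out, so that the whole ambient set counts as
  closed and maximality reads: a larger closed set is the ambient set.\<close>

definition closed_in :: "('v \<times> 'y) set \<Rightarrow> ('v \<times> 'y) set \<Rightarrow> bool" where
  "closed_in R \<Psi> \<longleftrightarrow> \<Psi> \<subseteq> R \<and> (\<forall>a\<in>\<Psi>. \<forall>b\<in>\<Psi>. refl_affine a b \<in> \<Psi>) \<and>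
     (\<forall>a\<in>\<Psi>. \<forall>b\<in>\<Psi>. a + b \<in> R \<longrightarrow> a + b \<in> \<Psi>)"

lemma closed_subroot_system_iff:
  "closed_subroot_system R \<Psi> \<longleftrightarrow> closed_in R \<Psi> \<and> \<Psi> \<noteq> {} \<and> \<Psi> \<noteq> R"
  unfolding closed_subroot_system_def subroot_system_def closed_in_def by blast

text \<open>The structure theory applies verbatim to both ambient sets, which is what allows
  maximality in one to be compared with maximality in the other.\<close>

definition ambient :: "('v \<times> 'y) set \<Rightarrow> bool" where
  "ambient R \<longleftrightarrow> R = RR \<or> R = BR"

lemma ambient_RR [simp]: "ambient RR" and ambient_BR [simp]: "ambient BR"
  by (simp_all add: ambient_def)

lemma BR_sub_RR: "BR \<subseteq> RR"
  by (auto simp: B_real_roots_def real_roots_def B_roots_def BC_roots_def)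

lemma ambient_sub: "ambient R \<Longrightarrow> R \<subseteq> RR" "ambient R \<Longrightarrow> BR \<subseteq> R"
  using BR_sub_RR by (auto simp: ambient_def)

lemma ambient_refl: "ambient R \<Longrightarrow> a \<in> R \<Longrightarrow> b \<in> R \<Longrightarrow> refl_affine a b \<in> R"
  using RR_refl BR_refl unfolding ambient_def by blast

lemma mem_ambient [simp]:
  assumes "ambient R"
  shows "k \<in> E \<Longrightarrow> (u k, y) \<in> R \<longleftrightarrow> y \<in> S"
    "k \<in> E \<Longrightarrow> m \<in> E \<Longrightarrow> k \<noteq> m \<Longrightarrow> k \<noteq> - m \<Longrightarrow> (u k + u m, y) \<in> R \<longleftrightarrow> y \<in> L"
  using assms by (auto simp: ambient_def)

lemma mem_RR_sum_L:
  assumes "k \<in> E" "m \<in> E" "k \<noteq> - m" "(u k + u m, y) \<in> RR"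
  shows "y \<in> L"
  using assms D_sub_L by (cases "k = m") auto

lemma RR_cases:
  assumes "(\<alpha>, y) \<in> RR"
  obtains (short) k where "k \<in> E" "\<alpha> = u k" "y \<in> S"
    | (long) k m where "k \<in> E" "m \<in> E" "k \<noteq> m" "k \<noteq> - m" "\<alpha> = u k + u m" "y \<in> L"
    | (div) k where "k \<in> E" "\<alpha> = u k + u k" "y \<in> D"
proof -
  have "\<alpha> \<in> BC" using assms by (simp add: real_roots_def)
  then show ?thesis
    by (cases rule: BC_cases) (use assms that in auto)
qed

lemma short_neq_sum: "j \<in> E \<Longrightarrow> k \<in> E \<Longrightarrow> m \<in> E \<Longrightarrow> k \<noteq> - m \<Longrightarrow> u j \<noteq> u k + u m"
  using root_kinds_disjoint(1,2) mem_kinds(1)[of j] mem_kinds(2)[of k m] mem_kinds(3)[of k]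
  by (cases "k = m") (metis disjoint_iff)+

text \<open>The axes are coloured by \<open>c\<close>, \<open>A b\<close> is the set of translations of short roots on axes of colour \<open>b\<close>,
  and \<open>H\<close> that of long and divisible roots within one colour, everything twisted by the linear map \<open>q\<close>.
  The divisible roots are cut down to \<open>D\<close> only by intersecting with the ambient set.\<close>

definition sys :: "('v \<Rightarrow> 'y) \<Rightarrow> (int \<Rightarrow> bool) \<Rightarrow> (bool \<Rightarrow> 'y set) \<Rightarrow> 'y set \<Rightarrow> ('v \<times> 'y) set" where
  "sys q c A H = {(u k, q (u k) + a) | k a. k \<in> E \<and> a \<in> A (c k)} \<union>
     {(u k + u m, q (u k + u m) + h) | k m h. k \<in> E \<and> m \<in> E \<and> k \<noteq> - m \<and> c k = c m \<and> h \<in> H}"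

lemma mem_sys [simp]:
  "k \<in> E \<Longrightarrow> (u k, y) \<in> sys q c A H \<longleftrightarrow> y - q (u k) \<in> A (c k)"
  "k \<in> E \<Longrightarrow> m \<in> E \<Longrightarrow> k \<noteq> - m \<Longrightarrow>
     (u k + u m, y) \<in> sys q c A H \<longleftrightarrow> c k = c m \<and> y - q (u k + u m) \<in> H"
proof -
  assume k: "k \<in> E"
  show "(u k, y) \<in> sys q c A H \<longleftrightarrow> y - q (u k) \<in> A (c k)"
  proof
    assume "(u k, y) \<in> sys q c A H"
    then consider j a where "u k = u j" "y = q (u j) + a" "j \<in> E" "a \<in> A (c j)"
      | j p where "j \<in> E" "p \<in> E" "j \<noteq> - p" "u k = u j + u p"
      unfolding sys_def by blast
    then show "y - q (u k) \<in> A (c k)"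
    proof cases
      case 1
      then have "k = j" using k u_eq_iff by metis
      then show ?thesis using 1 by simp
    next
      case 2 then show ?thesis using short_neq_sum k by metis
    qed
  next
    assume "y - q (u k) \<in> A (c k)"
    then show "(u k, y) \<in> sys q c A H"
      unfolding sys_def using k by (intro UnI1 CollectI exI[of _ k] exI[of _ "y - q (u k)"]) auto
  qed
  assume m: "m \<in> E" "k \<noteq> - m"
  show "(u k + u m, y) \<in> sys q c A H \<longleftrightarrow> c k = c m \<and> y - q (u k + u m) \<in> H"
  proof
    assume "(u k + u m, y) \<in> sys q c A H"
    then consider j where "u k + u m = u j" "j \<in> E"
      | j p h where "j \<in> E" "p \<in> E" "j \<noteq> - p" "c j = c p" "h \<in> H" "u k + u m = u j + u p"
        "y = q (u j + u p) + h"
      unfolding sys_def by blast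
    then show "c k = c m \<and> y - q (u k + u m) \<in> H"
    proof cases
      case 1 then show ?thesis using short_neq_sum k m by metis
    next
      case 2
      from u_sum_eq[OF k m(1) 2(1,2,6) m(2)] show ?thesis using 2(4-7) by (metis add_diff_cancel_left')
    qed
  next
    assume "c k = c m \<and> y - q (u k + u m) \<in> H"
    then show "(u k + u m, y) \<in> sys q c A H"
      unfolding sys_def using k m
      by (intro UnI2 CollectI exI[of _ k] exI[of _ m] exI[of _ "y - q (u k + u m)"]) auto
  qed
qed

lemma sys_cases:
  assumes "(\<alpha>, y) \<in> sys q c A H"
  obtains (short) k where "k \<in> E" "\<alpha> = u k" "y - q \<alpha> \<in> A (c k)"
    | (sum) k m where "k \<in> E" "m \<in> E" "k \<noteq> - m" "\<alpha> = u k + u m" "c k = c m" "y - q \<alpha> \<in> H"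
  using assms unfolding sys_def by fastforce

text \<open>The last clause is closedness under adding two short roots. Asking for it with
  \<open>L\<close> also handles divisible sums, since \<open>D\<close> lies in
  \<open>L\<close>.\<close>

definition sys_admissible :: "('v \<Rightarrow> 'y) \<Rightarrow> (int \<Rightarrow> bool) \<Rightarrow> (bool \<Rightarrow> 'y set) \<Rightarrow> 'y set \<Rightarrow> bool" where
  "sys_admissible q c A H \<longleftrightarrow> linear q \<and> (\<forall>k. c (- k) = c k) \<and>
     0 \<in> H \<and> (\<forall>h\<in>H. \<forall>h'\<in>H. h - h' \<in> H) \<and>
     (\<forall>b. \<forall>a\<in>A b. - a \<in> A b \<and> a + a \<in> H \<and> (\<forall>h\<in>H. a + h \<in> A b)) \<and>
     (\<forall>k\<in>E. \<forall>m\<in>E. \<forall>a\<in>A (c k). \<forall>b\<in>A (c m). k \<noteq> - m \<longrightarrow> q (u k + u m) + (a + b) \<in> L \<longrightarrow>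
        c k = c m \<and> a + b \<in> H)"

text \<open>These coefficients multiply the translation of the reflecting root. A short root with
  untwisted translation \<open>a\<close> contributes 0 or plus or minus \<open>a + a\<close>, an
  element of \<open>H\<close>; a long or divisible one contributes 0 or plus or minus an element of
  \<open>H\<close>.\<close>

lemma inner_coroot:
  assumes "f \<in> E" "e \<in> E"
  shows "u f \<bullet> coroot (u e) \<in> {0, 2, -2}"
    "g \<in> E \<Longrightarrow> e \<noteq> - g \<Longrightarrow> u f \<bullet> coroot (u e + u g) \<in> {0, 1, -1}"
proof -
  show "u f \<bullet> coroot (u e) \<in> {0, 2, -2}"
    using assms by (auto simp: coroot_def u_inner)
  assume g: "g \<in> E" "e \<noteq> - g"
  show "u f \<bullet> coroot (u e + u g) \<in> {0, 1, -1}"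
  proof (cases "e = g")
    case True
    have "u e \<bullet> u e = 1" "u f \<bullet> u e \<in> {0, 1, -1}" using assms by (simp_all add: u_inner)
    then show ?thesis using True by (auto simp: coroot_def inner_simps)
  next
    case False
    have "g \<noteq> - e" "g \<noteq> e" using g False by auto
    then have "u e \<bullet> u e = 1" "u g \<bullet> u g = 1" "u e \<bullet> u g = 0" "u g \<bullet> u e = 0"
      using assms g False by (simp_all add: u_inner)
    moreover have "u f \<bullet> u e + u f \<bullet> u g \<in> {0, 1, -1}"
      using assms g False u_inner[of f e] u_inner[of f g] by auto
    ultimately show ?thesis by (auto simp: coroot_def inner_simps)
  qed
qed

text \<open>After untwisting by \<open>q\<close>, every reflection shifts translations by elements
  of \<open>H\<close> and preserves colours. A sum with a long or divisible summand is a root only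
  if an opposite pair cancels, which leaves a sum of type A + H or H + H; two short roots are the
  last admissibility clause.\<close>

lemma closed_sys:
  assumes R: "ambient R" and ok: "sys_admissible q c A H"
  shows "closed_in R (sys q c A H \<inter> R)"
proof -
  let ?X = "sys q c A H"
  have lin: "linear q" and c [simp]: "\<And>k. c (- k) = c k" and H0: "0 \<in> H"
    and Hd: "\<And>h h'. h \<in> H \<Longrightarrow> h' \<in> H \<Longrightarrow> h - h' \<in> H"
    and An: "\<And>a b. a \<in> A b \<Longrightarrow> - a \<in> A b" and A2: "\<And>a b. a \<in> A b \<Longrightarrow> a + a \<in> H"
    and AH: "\<And>a b h. a \<in> A b \<Longrightarrow> h \<in> H \<Longrightarrow> a + h \<in> A b"
    and sum: "\<And>k m a b. k \<in> E \<Longrightarrow> m \<in> E \<Longrightarrow> a \<in> A (c k) \<Longrightarrow> b \<in> A (c m) \<Longrightarrow> k \<noteq> - m \<Longrightarrow>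
      q (u k + u m) + (a + b) \<in> L \<Longrightarrow> c k = c m \<and> a + b \<in> H"
    using ok unfolding sys_admissible_def by auto
  note q = linear_add[OF lin] linear_diff[OF lin] linear_scale[OF lin]
  have Hn: "- h \<in> H" if "h \<in> H" for h using Hd[OF H0 that] by simp
  have Ha: "h + h' \<in> H" if "h \<in> H" "h' \<in> H" for h h' using Hd[OF that(1) Hn[OF that(2)]] by simp
  have refl: "refl_affine a b \<in> ?X" if "a \<in> ?X" "b \<in> ?X" "a \<in> R" for a b
  proof -
    obtain \<alpha> z \<beta> y where ab: "a = (\<alpha>, z)" "b = (\<beta>, y)" by fastforce
    have \<alpha>: "\<alpha> \<in> BC" using that ambient_sub[OF R] ab by (auto simp: real_roots_def)
    obtain e g where eg: "e \<in> E" "g \<in> E" "e \<noteq> - g" "\<alpha> = u e \<and> e = g \<or> \<alpha> = u e + u g" and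
      r: "\<And>f (z::'y) y. f \<in> E \<Longrightarrow>
        refl_affine (\<alpha>, z) (u f, y) = (u (refl_perm e g f), y - (u f \<bullet> coroot \<alpha>) *\<^sub>R z)"
      using refl_root_perm[OF \<alpha>] by metis
    have ceg: "c e = c g"
      using eg that ab by (auto split: if_splits)
    have cp: "c (refl_perm e g f) = c f" for f using ceg c[of f] c[of e] c[of g]
      by (auto simp: refl_perm_def)
    have r': "u (refl_perm e g f) = u f - (u f \<bullet> coroot \<alpha>) *\<^sub>R \<alpha>" if "f \<in> E" for f
      using r[OF that] by (simp add: refl_affine_def refl_root_def)
    \<comment> \<open>The amount by which the reflection shifts the untwisted translation over
      \<open>u f\<close>.\<close>
    define t where "t f = (u f \<bullet> coroot \<alpha>) *\<^sub>R (z - q \<alpha>)" for f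
    have t: "t f \<in> H" if f: "f \<in> E" for f
      using eg(4)
    proof
      assume "\<alpha> = u e \<and> e = g"
      then have "z - q \<alpha> \<in> A (c e)" "u f \<bullet> coroot \<alpha> \<in> {0, 2, -2}"
        using inner_coroot(1)[OF f eg(1)] \<open>a \<in> ?X\<close> ab eg by auto
      moreover define w where "w = z - q \<alpha>"
      ultimately have "(u f \<bullet> coroot \<alpha>) *\<^sub>R w \<in> H"
        using A2[of w "c e"] Hn[of "w + w"] H0 by (auto simp: scaleR_2)
      then show ?thesis by (simp add: t_def w_def)
    next
      assume "\<alpha> = u e + u g"
      then have "z - q \<alpha> \<in> H" "u f \<bullet> coroot \<alpha> \<in> {0, 1, -1}"
        using inner_coroot(2)[OF f eg(1,2,3)] \<open>a \<in> ?X\<close> ab eg by auto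
      then show ?thesis using Hn H0 by (auto simp: t_def simp del: minus_diff_eq)
    qed
    have rq: "refl_affine a (u f, q (u f) + x) = (u (refl_perm e g f), q (u (refl_perm e g f)) + (x - t f))"
      if "f \<in> E" for f x
      using r[OF that] unfolding r'[OF that] ab by (simp add: q t_def scaleR_diff_right algebra_simps)
    note p = refl_perm[OF eg(1-3)]
    from \<open>b \<in> ?X\<close> show ?thesis unfolding ab(2)
    proof (cases rule: sys_cases)
      case (short f)
      have "y - q \<beta> - t f \<in> A (c f)" using AH[OF short(3) Hn[OF t[OF short(1)]]] by simp
      moreover have "refl_affine a (\<beta>, y) = (u (refl_perm e g f), q (u (refl_perm e g f)) + (y - q \<beta> - t f))"
        using rq[OF short(1), of "y - q \<beta>"] short(2) by simp
      ultimately show "refl_affine a (\<beta>, y) \<in> ?X" using p(1)[OF short(1)] cp by simp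
    next
      case (sum f f')
      \<comment> \<open>The whole untwisted translation is put on the first summand. Neither summand
        has to lie in the system, because \<open>refl_affine\<close> is additive everywhere.\<close>
      have "(\<beta>, y) = (u f, q (u f) + (y - q \<beta>)) + (u f', q (u f') + 0)"
        using sum by (simp add: q)
      then have *: "refl_affine a (\<beta>, y) = (u (refl_perm e g f) + u (refl_perm e g f'),
          q (u (refl_perm e g f) + u (refl_perm e g f')) + (y - q \<beta> - (t f + t f')))"
        using rq[OF sum(1)] rq[OF sum(2)] by (simp only: refl_affine_add) (simp add: q)
      have "y - q \<beta> - (t f + t f') \<in> H" using sum t Hd Ha by blast
      moreover have "refl_perm e g f \<noteq> - refl_perm e g f'" using p(2)[OF sum(1) _ sum(2)] sum(3) by blast
      ultimately show "refl_affine a (\<beta>, y) \<in> ?X"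
        unfolding * using p(1)[OF sum(1)] p(1)[OF sum(2)] sum(5) cp by simp
    qed
  qed
  have short_sum: "(u j + (u k + u m), y + z) \<in> ?X"
    if "(u j, y) \<in> ?X" "(u k + u m, z) \<in> ?X" "j = - k" "j \<in> E" "k \<in> E" "m \<in> E" "k \<noteq> - m"
    for j k m y z
  proof -
    have "c j = c m" "z - q (u k + u m) \<in> H" using that by auto
    then have "y - q (u j) \<in> A (c m)" "z - q (u k + u m) \<in> H"
      using that(1) unfolding mem_sys(1)[OF that(4)] by simp_all
    from AH[OF this] show ?thesis using that by (simp add: q linear_neg[OF lin] algebra_simps)
  qed
  have short_sum': "(u j + (u k + u m), y + z) \<in> ?X"
    if "(u j, y) \<in> ?X" "(u k + u m, z) \<in> ?X" "u j + (u k + u m) \<in> BC" "j \<in> E" "k \<in> E" "m \<in> E" "k \<noteq> - m"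
    for j k m y z
  proof -
    have "m \<noteq> - k" using that by auto
    then show ?thesis
      using root_sum_short[OF that(4-7,3)] short_sum[of j y k m z] short_sum[of j y m k z] that
      by (metis add.commute)
  qed
  have sum_sum: "((u j + u k) + (u m + u p), y + z) \<in> ?X"
    if "(u j + u k, y) \<in> ?X" "(u m + u p, z) \<in> ?X" "(u j + u k) + (u m + u p) \<in> BC" "j = - m"
      "j \<in> E" "k \<in> E" "m \<in> E" "p \<in> E" "j \<noteq> - k" "m \<noteq> - p"
    for j k m p y z
  proof -
    have *: "(u j + u k) + (u m + u p) = u k + u p" using that(4) by simp
    have "k \<noteq> - p" using that(3,4) root_kinds_disjoint(4) by auto
    moreover have "c j = c m" using that(4) by simp
    then have "c k = c p" "y - q (u j + u k) + (z - q (u m + u p)) \<in> H"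
      using that(1,2) Ha unfolding mem_sys(2)[OF that(5,6,9)] mem_sys(2)[OF that(7,8,10)] by blast+
    moreover have "y - q (u j + u k) + (z - q (u m + u p)) = y + z - q (u k + u p)"
      using that(4) by (simp add: q linear_neg[OF lin])
    ultimately show ?thesis unfolding * using that(6,8) by simp
  qed
  have sum_sum': "((u j + u k) + (u m + u p), y + z) \<in> ?X"
    if "(u j + u k, y) \<in> ?X" "(u m + u p, z) \<in> ?X" "(u j + u k) + (u m + u p) \<in> BC"
      "j \<in> E" "k \<in> E" "m \<in> E" "p \<in> E" "j \<noteq> - k" "m \<noteq> - p"
    for j k m p y z
  proof -
    have n: "k \<noteq> - j" "p \<noteq> - m" using that by auto
    from root_sum_long[OF that(4-9,3)] show ?thesis
    proof (elim disjE)
      assume "j = - m" then show ?thesis using sum_sum that by blast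
    next
      assume "j = - p"
      then show ?thesis using sum_sum[of j k y p m z] that n by (metis add.commute)
    next
      assume "k = - m"
      then show ?thesis using sum_sum[of k j y m p z] that n by (metis add.commute)
    next
      assume "k = - p"
      then show ?thesis using sum_sum[of k j y p m z] that n by (metis add.commute)
    qed
  qed
  have "a + b \<in> ?X" if "a \<in> ?X" "b \<in> ?X" "a + b \<in> R" for a b
  proof -
    obtain \<alpha> z \<beta> y where ab: "a = (\<alpha>, z)" "b = (\<beta>, y)" by fastforce
    have s: "(\<alpha> + \<beta>, z + y) \<in> RR" using that ab ambient_sub[OF R] by auto
    then have BC: "\<alpha> + \<beta> \<in> BC" "\<beta> + \<alpha> \<in> BC" by (auto simp: real_roots_def add.commute)
    have "(\<alpha> + \<beta>, z + y) \<in> ?X"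
      using that(1)[unfolded ab]
    proof (cases rule: sys_cases)
      case k: (short k)
      from that(2)[unfolded ab] show ?thesis
      proof (cases rule: sys_cases)
        case m: (short m)
        have "k \<noteq> - m" using BC k m root_kinds_disjoint(4) by auto
        moreover have "z + y \<in> L" using mem_RR_sum_L[of k m] k m s calculation by auto
        then have "q (u k + u m) + ((z - q \<alpha>) + (y - q \<beta>)) \<in> L" using k m by (simp add: q)
        ultimately have "c k = c m" "(z - q \<alpha>) + (y - q \<beta>) \<in> H" using sum k m by blast+
        then show ?thesis using k m \<open>k \<noteq> - m\<close> by (simp add: q algebra_simps)
      next
        case m: (sum m p)
        then show ?thesis using short_sum'[of k z m p y] that ab k BC by auto
      qed
    next
      case k: (sum k p)
      from that(2)[unfolded ab] show ?thesis
      proof (cases rule: sys_cases)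
        case m: (short m)
        then show ?thesis using short_sum'[of m y k p z] that ab k BC by (auto simp: add.commute)
      next
        case m: (sum m r)
        then show ?thesis using sum_sum'[of k p z m r y] that ab k BC by auto
      qed
    qed
    then show ?thesis using ab by simp
  qed
  then show ?thesis unfolding closed_in_def using refl ambient_refl[OF R] by auto
qed

subsection \<open>Closed subsystems and two-block systems\<close>

text \<open>From here on \<open>u (- k)\<close> is kept intact: rewriting it to \<open>- u k\<close> would hide it from the membership rules.\<close>

declare u_minus [simp del]

lemma refl_eq_0 [simp]: "u k + u (- k) = 0" "u (- k) + u k = 0"
  by (simp_all add: u_minus)

context
  fixes R \<Psi> assumes R: "ambient R" and cl: "closed_in R \<Psi>"
begin

lemma closed_in_sum: "a \<in> \<Psi> \<Longrightarrow> b \<in> \<Psi> \<Longrightarrow> a + b \<in> R \<Longrightarrow> a + b \<in> \<Psi>"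
  and closed_in_refl: "a \<in> \<Psi> \<Longrightarrow> b \<in> \<Psi> \<Longrightarrow> refl_affine a b \<in> \<Psi>"
  and closed_in_subset: "\<Psi> \<subseteq> R"
  using cl unfolding closed_in_def by blast+

lemma closed_in_mem: "k \<in> E \<Longrightarrow> (u k, y) \<in> \<Psi> \<Longrightarrow> y \<in> S"
  "k \<in> E \<Longrightarrow> m \<in> E \<Longrightarrow> k \<noteq> - m \<Longrightarrow> (u k + u m, y) \<in> \<Psi> \<Longrightarrow> y \<in> L"
  using closed_in_subset R mem_RR_sum_L ambient_sub(1)[OF R] by auto

lemma closed_in_neg: "a \<in> \<Psi> \<Longrightarrow> - a \<in> \<Psi>"
proof -
  assume a: "a \<in> \<Psi>"
  then have "fst a \<in> BC" using closed_in_subset ambient_sub(1)[OF R] by (auto simp: real_roots_def)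
  then have "fst a \<noteq> 0" using root_kinds_disjoint(4) by metis
  then show ?thesis using refl_affine_self[of a] closed_in_refl[OF a a] by simp
qed

lemma closed_in_neg_short: "(u k, y) \<in> \<Psi> \<Longrightarrow> (u (- k), - y) \<in> \<Psi>"
  using closed_in_neg[of "(u k, y)"] by (simp add: u_minus)

lemma closed_in_short_short:
  assumes "(u k, y) \<in> \<Psi>" "(u m, z) \<in> \<Psi>" "y + z \<in> L" "k \<in> E" "m \<in> E" "k \<noteq> m" "k \<noteq> - m"
  shows "(u k + u m, y + z) \<in> \<Psi>"
  using closed_in_sum[OF assms(1,2)] assms R by simp

lemma closed_in_short_long:
  assumes "(u k, y) \<in> \<Psi>" "(u (- k) + u m, z) \<in> \<Psi>" "k \<in> E" "m \<in> E" "k \<noteq> m"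
  shows "(u m, y + z) \<in> \<Psi>"
proof -
  have "z \<in> L" using closed_in_mem(2)[of "- k" m z] assms by auto
  then have "y + z \<in> S" using closed_in_mem(1) assms S_add_L by blast
  then show ?thesis using closed_in_sum[OF assms(1,2)] assms R by (simp add: add.assoc[symmetric])
qed

lemma closed_in_long_long:
  assumes "(u j + u k, y) \<in> \<Psi>" "(u (- k) + u m, z) \<in> \<Psi>" "j \<in> E" "k \<in> E" "m \<in> E"
    "j \<noteq> m" "j \<noteq> - m" "j \<noteq> - k" "k \<noteq> m"
  shows "(u j + u m, y + z) \<in> \<Psi>"
proof -
  have "y \<in> L" "z \<in> L" using closed_in_mem(2)[of j k y] closed_in_mem(2)[of "- k" m z] assms by auto
  then have "(u j + u m, y + z) \<in> R" using L_add assms R by simp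
  moreover have "(u j + u m, y + z) = (u j + u k, y) + (u (- k) + u m, z)"
    by (simp add: u_minus)
  ultimately show ?thesis using closed_in_sum[OF assms(1,2)] by metis
qed

lemma closed_in_flip:
  assumes "(u k, z) \<in> \<Psi>" "(u k + u m, y) \<in> \<Psi>" "k \<in> E" "m \<in> E" "k \<noteq> m" "k \<noteq> - m"
  shows "(u (- k) + u m, y - (z + z)) \<in> \<Psi>"
proof -
  have "m \<noteq> k" "m \<noteq> - k" "k \<noteq> - k" using assms E_nonzero(3)[of k] by auto
  then have "refl_affine (u k, z) (u k + u m, y) = (u (- k) + u m, y - (z + z))"
    using refl_affine_add[of "(u k, z)" "(u k, y)" "(u m, 0)"] refl_short(1)[of k k z y]
      refl_short(1)[of k m z 0] assms by (simp add: refl_perm_def u_inner scaleR_2)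
  then show ?thesis using closed_in_refl[OF assms(1,2)] by simp
qed

text \<open>A long or divisible root with translation y is the sum of short roots with translations
  y and 0, both of which lie in S.\<close>

lemma closed_eq_ambient:
  assumes "\<And>k y. k \<in> E \<Longrightarrow> y \<in> S \<Longrightarrow> (u k, y) \<in> \<Psi>"
  shows "\<Psi> = R"
proof
  show "\<Psi> \<subseteq> R" by (rule closed_in_subset)
  show "R \<subseteq> \<Psi>"
  proof
    fix a assume a: "a \<in> R"
    obtain \<alpha> y where ay: "a = (\<alpha>, y)" by fastforce
    then have "(\<alpha>, y) \<in> RR" using a ambient_sub[OF R] by auto
    then show "a \<in> \<Psi>"
    proof (cases rule: RR_cases)
      case (short k) then show ?thesis using assms ay by simp
    next
      case (long k m)
      then show ?thesis using closed_in_short_short[of k y m 0] assms ay L_sub_S by simp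
    next
      case (div k)
      then have "(u k, y) \<in> \<Psi>" "(u k, 0) \<in> \<Psi>" using assms D_sub_L L_sub_S by auto
      then show ?thesis using closed_in_sum[of "(u k, y)" "(u k, 0)"] ay a div by simp
    qed
  qed
qed

end

lemma ex_third:
  assumes "k \<in> E" obtains j where "j \<in> E" "j \<noteq> k" "j \<noteq> - k" "k \<noteq> j" "k \<noteq> - j"
proof (cases "k = 1 \<or> k = - 1")
  case True then show ?thesis using that[of 2] E12(2) by auto
next
  case False then show ?thesis using that[of 1] E12(1) by auto
qed

abbreviation blk :: "(int \<Rightarrow> bool) \<Rightarrow> (bool \<Rightarrow> 'y set) \<Rightarrow> ('v \<times> 'y) set" where
  "blk c A \<equiv> sys (\<lambda>_. 0) c A L"

text \<open>Both colours must occur, but one of the two parts of \<open>S\<close> may be empty: this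
  includes the systems \<open>A_hat\<close> with non-empty \<open>J\<close>.\<close>

definition splits :: "(int \<Rightarrow> bool) \<Rightarrow> (bool \<Rightarrow> 'y set) \<Rightarrow> bool" where
  "splits c A \<longleftrightarrow> (\<forall>k. c (- k) = c k) \<and> (\<exists>k\<in>E. c k) \<and> (\<exists>k\<in>E. \<not> c k) \<and>
     A True \<union> A False = S \<and> A True \<inter> A False = {} \<and>
     (\<forall>b. \<forall>a\<in>A b. - a \<in> A b \<and> (\<forall>h\<in>L. a + h \<in> A b))"

text \<open>Short roots of different colours never add up to a root: if a + b lies in L, then b lies
  in the L-coset of -a, hence in the same part as a, and the parts are disjoint.\<close>

lemma splits_admissible: "splits c A \<Longrightarrow> sys_admissible (\<lambda>_. 0) c A L"
proof -
  assume s: "splits c A"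
  then have AS: "A b \<subseteq> S" for b unfolding splits_def by (cases b) auto
  have "c k = c m" if "a \<in> A (c k)" "b \<in> A (c m)" "a + b \<in> L" for a b k m
  proof (rule ccontr)
    assume "c k \<noteq> c m"
    moreover have "- a + (a + b) \<in> A (c k)" using s that unfolding splits_def by blast
    ultimately show False using that(2) s unfolding splits_def
      by (cases "c k"; cases "c m") auto
  qed
  moreover have "a + a \<in> L" if "a \<in> A b" for a b using AS two_S that by blast
  ultimately show ?thesis using s L_diff
    unfolding sys_admissible_def splits_def by (auto simp: linear_iff)
qed

lemma maximalI:
  assumes "closed_in R \<Psi>" "\<Psi> \<noteq> {}" "\<Psi> \<noteq> R"
    and "\<And>\<Psi>''. closed_in R \<Psi>'' \<Longrightarrow> \<Psi> \<subset> \<Psi>'' \<Longrightarrow> \<Psi>'' = R"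
  shows "maximal_closed_subroot_system R \<Psi>"
  using assms unfolding maximal_closed_subroot_system_def closed_subroot_system_iff by blast

lemma maximalD:
  assumes "maximal_closed_subroot_system R \<Psi>"
  shows "closed_in R \<Psi>" "\<Psi> \<noteq> {}" "\<Psi> \<noteq> R"
    and "closed_in R \<Psi>'' \<Longrightarrow> \<Psi> \<subseteq> \<Psi>'' \<Longrightarrow> \<Psi>'' \<noteq> R \<Longrightarrow> \<Psi>'' = \<Psi>"
  using assms unfolding maximal_closed_subroot_system_def closed_subroot_system_iff closed_in_def
  by blast+

lemma blk_proper:
  assumes R: "ambient R" and s: "splits c A"
  shows "blk c A \<inter> R \<noteq> {}" "blk c A \<inter> R \<noteq> R"
proof -
  obtain k m where km: "k \<in> E" "m \<in> E" "c k" "\<not> c m" "k \<noteq> m" "k \<noteq> - m"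
    using s unfolding splits_def by metis
  then have "(u k + u m, 0) \<in> R" "(u k + u m, 0) \<notin> blk c A" using R by simp_all
  then show "blk c A \<inter> R \<noteq> R" by blast
  obtain b where b: "0 \<in> A b" using S_0 s unfolding splits_def by blast
  obtain j where "j \<in> E" "c j = b" using km by (cases b) auto
  then have "(u j, 0) \<in> blk c A \<inter> R" using b R by simp
  then show "blk c A \<inter> R \<noteq> {}" by blast
qed

text \<open>Anything new produces a long root between the blocks. It carries each part of
  \<open>S\<close> over to the other block, so all of \<open>S\<close> appears over one axis of each
  block and then spreads within the blocks.\<close>

lemma blk_maximal:
  assumes R: "ambient R" and s: "splits c A"
  shows "maximal_closed_subroot_system R (blk c A \<inter> R)"
proof (rule maximalI)
  show "closed_in R (blk c A \<inter> R)" using closed_sys[OF R splits_admissible[OF s]] .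
  show "blk c A \<inter> R \<noteq> {}" "blk c A \<inter> R \<noteq> R" using blk_proper[OF R s] .
next
  fix X assume X: "closed_in R X" and sub: "blk c A \<inter> R \<subset> X"
  note cl = closed_in_sum[OF R X] closed_in_short_short[OF R X] closed_in_short_long[OF R X] closed_in_neg_short[OF R X]
  have c [simp]: "\<And>k. c (- k) = c k" and c1: "\<exists>k\<in>E. c k" "\<exists>k\<in>E. \<not> c k"
    and AS: "A True \<union> A False = S"
    and An: "\<And>a b. a \<in> A b \<Longrightarrow> - a \<in> A b" and AL: "\<And>a b h. a \<in> A b \<Longrightarrow> h \<in> L \<Longrightarrow> a + h \<in> A b"
    using s unfolding splits_def by auto
  have other: "\<exists>m\<in>E. c m = (\<not> c k)" for k using c1 by (cases "c k") auto
  have A_S: "a \<in> A b \<Longrightarrow> a \<in> S" for a b using AS by (cases b) auto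
  have short: "(u k, a) \<in> X" if "k \<in> E" "a \<in> A (c k)" for k a
  proof -
    have "(u k, a) \<in> blk c A \<inter> R" using that A_S R by simp
    then show ?thesis using sub by blast
  qed
  have long: "(u k + u m, h) \<in> X" if "k \<in> E" "m \<in> E" "k \<noteq> m" "k \<noteq> - m" "c k = c m" "h \<in> L" for k m h
  proof -
    have "(u k + u m, h) \<in> blk c A \<inter> R" using that R by simp
    then show ?thesis using sub by blast
  qed
  \<comment> \<open>A new short root over \<open>k\<close> has its translation y in the part of the
    other colour, so some short root over an axis \<open>m\<close> of that colour has translation
    -y, and the two add up to a long root. A new long root joins the blocks already, and no
    divisible root can be new.\<close>
  have cross: "\<exists>k\<in>E. \<exists>m\<in>E. c k \<noteq> c m \<and> (\<exists>l. (u k + u m, l) \<in> X)"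
  proof -
    obtain \<alpha> y where a: "(\<alpha>, y) \<in> X" "(\<alpha>, y) \<notin> blk c A" using sub closed_in_subset[OF R X] by auto
    then have "(\<alpha>, y) \<in> RR" using closed_in_subset[OF R X] ambient_sub(1)[OF R] by auto
    then show ?thesis
    proof (cases rule: RR_cases)
      case (short k)
      obtain m where m: "m \<in> E" "c m = (\<not> c k)" using other by blast
      then have km: "k \<noteq> m" "k \<noteq> - m" by auto
      have "y \<in> A (c m)" using short a AS m by (cases "c k") auto
      then have "(u m, - y) \<in> X" using An m \<open>\<And>k a. k \<in> E \<Longrightarrow> a \<in> A (c k) \<Longrightarrow> (u k, a) \<in> X\<close> by blast
      then have "(u k + u m, y + - y) \<in> X" using cl(2) a(1) short m km by (metis L_0 add.right_inverse)
      then show ?thesis using m short by blast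
    next
      case (long k m)
      then have "c k \<noteq> c m" using a by auto
      then show ?thesis using a long by blast
    next
      case (div k)
      then show ?thesis using a D_sub_L E_nonzero(3)[of k] by auto
    qed
  qed
  then obtain k m l where km: "k \<in> E" "m \<in> E" "c k \<noteq> c m" "(u k + u m, l) \<in> X" by blast
  then have ne: "k \<noteq> m" "k \<noteq> - m" "m \<noteq> - k" by auto
  \<comment> \<open>A translation missing from the part of \<open>m\<close> lies in the part of
    \<open>k\<close>, and so does its shift by \<open>l\<close>; the long root between the blocks
    moves it from \<open>- k\<close> to \<open>m\<close>.\<close>
  have step: "(u m, a) \<in> X" if "k \<in> E" "m \<in> E" "c k \<noteq> c m" "(u k + u m, l) \<in> X" "a \<in> S" for k m a
  proof (cases "a \<in> A (c m)")
    case True then show ?thesis using short that by blast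
  next
    case False
    have ne: "k \<noteq> - m" "k \<noteq> m" using that by auto
    have "l \<in> L" using closed_in_mem(2)[OF R X that(1,2) ne(1) that(4)] .
    moreover have "a \<in> A (c k)" using False that AS by (cases "c k"; cases "c m") auto
    ultimately have "a - l \<in> A (c (- k))" using AL[of a "c k" "- l"] L_neg by simp
    then have "(u (- k), a - l) \<in> X" using short[of "- k" "a - l"] that(1) by simp
    then show ?thesis using cl(3)[of "- k" "a - l" m l] that ne by auto
  qed
  \<comment> \<open>Within a block the long roots with translation 0 transport everything; the
    opposite index is reached by negation, as \<open>S\<close> is symmetric.\<close>
  have step': "(u j, a) \<in> X" if "k \<in> E" "j \<in> E" "c k = c j" "\<And>a. a \<in> S \<Longrightarrow> (u k, a) \<in> X" "a \<in> S" for k j a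
  proof -
    consider "j = k" | "j = - k" | "j \<noteq> k" "j \<noteq> - k" by blast
    then show ?thesis
    proof cases
      case 1 then show ?thesis using that by blast
    next
      case 2 then show ?thesis using cl(4)[OF that(4)[OF S_neg[OF that(5)]]] by simp
    next
      case 3
      then have "- k \<noteq> j" "- k \<noteq> - j" "k \<noteq> j" by auto
      then show ?thesis using cl(3)[of k a j 0] long[of "- k" j 0] that by simp
    qed
  qed
  have "(u j, a) \<in> X" if "j \<in> E" "a \<in> S" for j a
  proof (cases "c j = c m")
    case True then show ?thesis using step'[OF km(2) that(1) _ step[OF km]] that by auto
  next
    case False
    have "(u m + u k, l) \<in> X" using km(4) by (simp add: add.commute)
    then show ?thesis using step'[OF km(1) that(1) _ step[OF km(2,1) km(3)[symmetric]]] that km(3) False by auto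
  qed
  then show "X = R" using closed_eq_ambient[OF R X] by blast
qed

subsection \<open>Shape of a closed subsystem\<close>

text \<open>Together with 0 in \<open>A True\<close> and in \<open>H\<close>, the last two clauses
  make the base points \<open>q (u k)\<close> and \<open>q (u k + u m)\<close> members of the
  system, so every short and every long root occurs.\<close>

definition full_sys :: "('v \<Rightarrow> 'y) \<Rightarrow> (bool \<Rightarrow> 'y set) \<Rightarrow> 'y set \<Rightarrow> bool" where
  "full_sys q A H \<longleftrightarrow> sys_admissible q (\<lambda>_. True) A H \<and> 0 \<in> A True \<and> (\<forall>k\<in>E. q (u k) \<in> S) \<and>
     (\<forall>k\<in>E. \<forall>m\<in>E. q (u k + u m) \<in> L)"

context
  fixes R \<Psi> assumes R: "ambient R" and cl: "closed_in R \<Psi>"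
begin

lemma sub_blkI:
  assumes "\<And>k y. k \<in> E \<Longrightarrow> (u k, y) \<in> \<Psi> \<Longrightarrow> y \<in> A (c k)"
    and "\<And>k m y. k \<in> E \<Longrightarrow> m \<in> E \<Longrightarrow> k \<noteq> m \<Longrightarrow> k \<noteq> - m \<Longrightarrow> (u k + u m, y) \<in> \<Psi> \<Longrightarrow> c k = c m"
  shows "\<Psi> \<subseteq> blk c A"
proof
  fix a assume a: "a \<in> \<Psi>"
  obtain \<alpha> y where ay: "a = (\<alpha>, y)" by fastforce
  then have "(\<alpha>, y) \<in> RR" using a closed_in_subset[OF R cl] ambient_sub(1)[OF R] by auto
  then show "a \<in> blk c A"
  proof (cases rule: RR_cases)
    case (short k) then show ?thesis using assms(1) a ay by simp
  next
    case (long k m) then show ?thesis using assms(2) a ay by simp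
  next
    case (div k) then show ?thesis using D_sub_L a ay E_nonzero(3) by simp
  qed
qed

text \<open>A long root between an axis with short roots and one without would carry a short root
  onto the latter, so colouring the axes by occurrence leaves no long root between the
  blocks.\<close>

lemma some_short_missing:
  assumes "k \<in> E" "(u k, y) \<in> \<Psi>" "m \<in> E" "\<And>y. (u m, y) \<notin> \<Psi>"
  defines "c \<equiv> \<lambda>k. \<exists>y. (u k, y) \<in> \<Psi>" and "A \<equiv> \<lambda>b. if b then S else {}"
  shows "splits c A" "\<Psi> \<subseteq> blk c A"
proof -
  have c: "c (- k) = c k" for k
    unfolding c_def using closed_in_neg_short[OF R cl, of k] closed_in_neg_short[OF R cl, of "- k"] by auto
  have "c k" "\<not> c m" using assms(2,4) by (auto simp: c_def)
  then show "splits c A"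
    using c assms(1,3) S_neg S_add_L unfolding splits_def by (auto simp: A_def)
  show "\<Psi> \<subseteq> blk c A"
  proof (rule sub_blkI)
    fix k y assume "k \<in> E" "(u k, y) \<in> \<Psi>"
    then show "y \<in> A (c k)" using closed_in_mem(1)[OF R cl] by (auto simp: A_def c_def)
  next
    fix k m y assume km: "k \<in> E" "m \<in> E" "k \<noteq> m" "k \<noteq> - m" "(u k + u m, y) \<in> \<Psi>"
    have "c m" if ck: "c k" and that: "k \<in> E" "m \<in> E" "k \<noteq> m" "k \<noteq> - m" "(u k + u m, y) \<in> \<Psi>" for k m
    proof -
      obtain z where "(u (- k), z) \<in> \<Psi>" using ck c[of k] unfolding c_def by blast
      then have "(u m, z + y) \<in> \<Psi>" using closed_in_short_long[OF R cl, of "- k" z m y] that by auto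
      then show ?thesis by (auto simp: c_def)
    qed
    from this[of k m] this[of m k] km show "c k = c m"
      by (metis add.commute minus_minus)
  qed
qed

text \<open>The block of \<open>i\<close> consists of the axes joined to it by a long root;
  reflections in short roots make this independent of signs, and sums of long roots make it
  transitive. \<open>A True\<close> collects the L-cosets met by short roots over this block. A
  short root over another axis with translation in such a coset could be combined with the negative
  of one over the block to give a forbidden long root.\<close>

lemma some_long_missing:
  assumes sh: "\<And>k. k \<in> E \<Longrightarrow> \<exists>y. (u k, y) \<in> \<Psi>"
    and i: "i \<in> E" and j: "j \<in> E" and ij: "i \<noteq> j" "i \<noteq> - j" "\<And>y. (u i + u j, y) \<notin> \<Psi>"
  obtains c A where "splits c A" "\<Psi> \<subseteq> blk c A" "A True \<noteq> {}" "A False \<noteq> {}"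
proof -
  define c where "c a \<longleftrightarrow> a = i \<or> a = - i \<or> (\<exists>y. (u i + u a, y) \<in> \<Psi>)" for a
  define A where "A b = {y \<in> S. (\<exists>k\<in>E. c k \<and> (\<exists>z. (u k, z) \<in> \<Psi> \<and> y - z \<in> L)) = b}" for b
  note neg = closed_in_neg_short[OF R cl]
  have flip: "\<exists>y. (u (- k) + u m, y) \<in> \<Psi>"
    if "(u k + u m, y) \<in> \<Psi>" "k \<in> E" "m \<in> E" "k \<noteq> m" "k \<noteq> - m" for k m y
    using sh[OF that(2)] closed_in_flip[OF R cl _ that] by blast
  have c1: "c (- k)" if ck: "c k" "k \<in> E" for k
  proof (cases "k = i \<or> k = - i")
    case True then show ?thesis by (auto simp: c_def)
  next
    case False
    then obtain y where "(u i + u k, y) \<in> \<Psi>" using ck by (auto simp: c_def)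
    then have "(u k + u i, y) \<in> \<Psi>" by (simp add: add.commute)
    then obtain y' where "(u (- k) + u i, y') \<in> \<Psi>" using flip[of k i] False ck i by auto
    then show ?thesis by (auto simp: c_def add.commute)
  qed
  have c: "c (- k) = c k" if "k \<in> E" for k using c1[of k] c1[of "- k"] that by auto
  have ci: "c i" and cj: "\<not> c j" using ij by (auto simp: c_def)
  have cross: "(u k + u m, y) \<notin> \<Psi>" if "k \<in> E" "m \<in> E" "c k" "\<not> c m" for k m y
  proof
    assume km: "(u k + u m, y) \<in> \<Psi>"
    have ne: "k \<noteq> m" "k \<noteq> - m" "i \<noteq> m" "i \<noteq> - m" "- k \<noteq> m" "- k \<noteq> - m" using that c i ci by auto
    have "\<exists>y. (u i + u m, y) \<in> \<Psi>"
    proof (cases "k = i \<or> k = - i")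
      case True then show ?thesis using km flip[OF km] that ne by auto
    next
      case False
      then have "i \<noteq> - k" by auto
      have "c (- k)" using c that by simp
      moreover have "- k \<noteq> i" "- k \<noteq> - i" using False by auto
      ultimately obtain z where "(u i + u (- k), z) \<in> \<Psi>" unfolding c_def by blast
      then show ?thesis using closed_in_long_long[OF R cl, of i "- k" z m y] km i that ne False by auto
    qed
    then show False using that by (auto simp: c_def)
  qed
  \<comment> \<open>\<open>splits\<close> asks for symmetry at all integers, whereas
    \<open>c\<close> is only known to be symmetric on \<open>E\<close>.\<close>
  define c' where "c' k \<longleftrightarrow> k \<in> E \<and> c k" for k
  have "splits c' A"
    unfolding splits_def
  proof (intro conjI allI ballI)
    show "c' (- k) = c' k" for k using c[of k] by (auto simp: c'_def)
    show "\<exists>k\<in>E. c' k" "\<exists>k\<in>E. \<not> c' k" using i j ci cj by (auto simp: c'_def)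
    show "A True \<union> A False = S" "A True \<inter> A False = {}" by (auto simp: A_def)
    have n: "\<exists>k\<in>E. c k \<and> (\<exists>z. (u k, z) \<in> \<Psi> \<and> - y - z \<in> L)"
      if ex: "\<exists>k\<in>E. c k \<and> (\<exists>z. (u k, z) \<in> \<Psi> \<and> y - z \<in> L)" for y
    proof -
      obtain k z where k: "k \<in> E" "c k" "(u k, z) \<in> \<Psi>" "y - z \<in> L" using ex by blast
      have "- y - - z \<in> L" using L_neg[OF k(4)] by (simp add: algebra_simps)
      then show ?thesis using k(1,2) c neg[OF k(3)] E_minus by metis
    qed
    show "- a \<in> A b" if "a \<in> A b" for a b
      using that n[of a] n[of "- a"] S_neg by (auto simp: A_def)
    have ad: "\<exists>k\<in>E. c k \<and> (\<exists>z. (u k, z) \<in> \<Psi> \<and> y + h - z \<in> L)"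
      if ex: "\<exists>k\<in>E. c k \<and> (\<exists>z. (u k, z) \<in> \<Psi> \<and> y - z \<in> L)" and h: "h \<in> L" for y h
    proof -
      obtain k z where k: "k \<in> E" "c k" "(u k, z) \<in> \<Psi>" "y - z \<in> L" using ex by blast
      have "y + h - z \<in> L" using L_add[OF k(4) h] by (simp add: algebra_simps)
      then show ?thesis using k by blast
    qed
    show "a + h \<in> A b" if "a \<in> A b" "h \<in> L" for a b h
      using that ad[of a h] ad[of "a + h" "- h"] S_add_L L_neg by (auto simp: A_def)
  qed
  moreover have key: "y \<in> A (c' k)" if "k \<in> E" "(u k, y) \<in> \<Psi>" for k y
  proof -
    have y: "y \<in> S" using closed_in_mem(1)[OF R cl] that by blast
    show ?thesis
    proof (cases "c k")
      case True
      moreover have "y - y \<in> L" by simp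
      ultimately show ?thesis using that y unfolding A_def c'_def by blast
    next
      case False
      have "\<not> (\<exists>m\<in>E. c m \<and> (\<exists>z. (u m, z) \<in> \<Psi> \<and> y - z \<in> L))"
      proof
        assume "\<exists>m\<in>E. c m \<and> (\<exists>z. (u m, z) \<in> \<Psi> \<and> y - z \<in> L)"
        then obtain m z where m: "m \<in> E" "c m" "(u m, z) \<in> \<Psi>" "y - z \<in> L" by blast
        have cm: "c (- m)" using c m by simp
        then have "- m \<noteq> k" "- m \<noteq> - k" using False m(2) by auto
        then have "(u (- m) + u k, - z + y) \<in> \<Psi>"
          using closed_in_short_short[OF R cl neg[OF m(3)] that(2)] m that by auto
        then show False using cross[of "- m" k] m that cm False by auto
      qed
      then show ?thesis using False y unfolding A_def c'_def by blast
    qed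
  qed
  moreover have "\<Psi> \<subseteq> blk c' A"
  proof (rule sub_blkI)
    show "y \<in> A (c' k)" if "k \<in> E" "(u k, y) \<in> \<Psi>" for k y using key that .
    fix k m y assume km: "k \<in> E" "m \<in> E" "(u k + u m, y) \<in> \<Psi>"
    then show "c' k = c' m"
      using cross[of k m y] cross[of m k y] by (auto simp: c'_def add.commute)
  qed
  moreover have "A True \<noteq> {}" "A False \<noteq> {}"
    using key[OF i] key[OF j] sh[OF i] sh[OF j] ci cj i j by (auto simp: c'_def)
  ultimately show ?thesis using that by blast
qed

text \<open>Over every axis a base point is chosen that is itself in \<Psi>. Long roots between base
  points then transport short translations unchanged, so the translations relative to
  \<open>q\<close> do not depend on the axis.\<close>

lemma all_present:
  assumes sh: "\<And>k. k \<in> E \<Longrightarrow> \<exists>y. (u k, y) \<in> \<Psi>"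
    and lo: "\<And>k m. k \<in> E \<Longrightarrow> m \<in> E \<Longrightarrow> k \<noteq> m \<Longrightarrow> k \<noteq> - m \<Longrightarrow> \<exists>y. (u k + u m, y) \<in> \<Psi>"
  obtains q A H where "full_sys q A H" "\<Psi> = sys q (\<lambda>_. True) A H \<inter> R"
proof -
  note neg = closed_in_neg_short[OF R cl] and ss = closed_in_short_short[OF R cl] and sl = closed_in_short_long[OF R cl]
    and ll = closed_in_long_long[OF R cl] and mem = closed_in_mem[OF R cl]
  obtain y1 where y1: "(u 1, y1) \<in> \<Psi>" using sh[OF E12(1)] by blast
  \<comment> \<open>The value 0 at axis 1 is a convention making \<open>y1\<close> its own base
    point. The other base points are reached from it by a long root, not chosen freely, which keeps
    them in the L-coset of \<open>y1\<close>.\<close>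
  have "\<exists>l. if i = 1 then l = 0 else (u (- 1) + u (int i), l) \<in> \<Psi>" if "i \<in> {1..n}" for i
    using lo[of "- 1" "int i"] E_nat(1)[OF that] E12(1) by auto
  then obtain l where l: "\<And>i. i \<in> {1..n} \<Longrightarrow> if i = 1 then l i = 0 else (u (- 1) + u (int i), l i) \<in> \<Psi>"
    by metis
  \<comment> \<open>The linear map with value \<open>y1 + l i\<close> at the i-th basis
    vector.\<close>
  define q where "q v = (\<Sum>i = 1..n. (v \<bullet> u (int i)) *\<^sub>R (y1 + l i))" for v
  have lin: "linear q"
    unfolding q_def by (rule linearI)
      (simp_all add: inner_add_left scaleR_left_distrib sum.distrib scaleR_sum_right)
  note q = linear_add[OF lin] linear_diff[OF lin] linear_neg[OF lin]
  have q_int: "q (u (int i)) = y1 + l i" if "i \<in> {1..n}" for i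
  proof -
    have "q (u (int i)) = (\<Sum>j = 1..n. if i = j then y1 + l j else 0)"
      unfolding q_def using that by (intro sum.cong) (auto simp: u_inner E_nat(1))
    then show ?thesis using that by simp
  qed
  have q_pos: "(u (int i), q (u (int i))) \<in> \<Psi> \<and> q (u (int i)) - y1 \<in> L" if i: "i \<in> {1..n}" for i
  proof (cases "i = 1")
    case True then show ?thesis using l[OF i] q_int[OF i] y1 by simp
  next
    case False
    then have li: "(u (- 1) + u (int i), l i) \<in> \<Psi>" using l[OF i] by simp
    then show ?thesis using sl[OF y1 li] mem(2)[OF _ _ _ li] E_nat(1)[OF i] q_int[OF i] E12(1) False by simp
  qed
  have E_sign: "(\<exists>i\<in>{1..n}. k = int i) \<or> (\<exists>i\<in>{1..n}. k = - int i)" if "k \<in> E" for k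
    using that unfolding E_def by (cases "k > 0") (auto intro!: bexI[of _ "nat \<bar>k\<bar>"])
  have q0: "(u k, q (u k)) \<in> \<Psi> \<and> q (u k) - y1 \<in> L" if k: "k \<in> E" for k
    using E_sign[OF k]
  proof
    assume "\<exists>i\<in>{1..n}. k = int i" then show ?thesis using q_pos by blast
  next
    assume "\<exists>i\<in>{1..n}. k = - int i"
    then obtain i where i: "i \<in> {1..n}" "k = - int i" by blast
    have "(u k, - q (u (int i))) \<in> \<Psi>" using neg q_pos[OF i(1)] i(2) by blast
    moreover have "q (u k) = - q (u (int i))" using i by (simp add: u_minus q)
    \<comment> \<open>Negation preserves the coset of \<open>y1\<close>, because
      \<open>y1 + y1\<close> lies in \<open>L\<close>.\<close>
    moreover have "- (q (u (int i)) - y1) - (y1 + y1) \<in> L"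
      using q_pos[OF i(1)] mem(1)[OF E12(1) y1] L_diff[of "- (q (u (int i)) - y1)" "y1 + y1"]
        L_neg[of "q (u (int i)) - y1"] two_S[of y1] by blast
    moreover have "- (q (u (int i)) - y1) - (y1 + y1) = - q (u (int i)) - y1" by simp
    ultimately show ?thesis by metis
  qed
  have qS: "q (u k) \<in> S" if "k \<in> E" for k using q0 mem(1) that by blast
  have qL: "q (u k + u m) \<in> L" if "k \<in> E" "m \<in> E" for k m
  proof -
    have "(q (u k) - y1) + (q (u m) - y1) + (y1 + y1) \<in> L"
      using L_add[OF L_add[OF conjunct2[OF q0[OF that(1)]] conjunct2[OF q0[OF that(2)]]]
          two_S[OF mem(1)[OF E12(1) y1]]] .
    moreover have "(q (u k) - y1) + (q (u m) - y1) + (y1 + y1) = q (u k + u m)" by (simp add: q)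
    ultimately show ?thesis by metis
  qed
  have qlong: "(u k + u m, q (u k + u m)) \<in> \<Psi>" if "k \<in> E" "m \<in> E" "k \<noteq> m" "k \<noteq> - m" for k m
    using ss[of k "q (u k)" m "q (u m)"] q0 qL[of k m] that by (simp add: q)
  \<comment> \<open>Translations over axis 1 measured from the base point; \<open>mv\<close> shows
    that every other index gives the same set.\<close>
  define A where "A = {a. (u 1, q (u 1) + a) \<in> \<Psi>}"
  define H where "H = A \<inter> L"
  have mv1: "(u m, q (u m) + (a + h)) \<in> \<Psi>"
    if "(u k, q (u k) + a) \<in> \<Psi>" "(u (- k) + u m, q (u (- k) + u m) + h) \<in> \<Psi>" "k \<in> E" "m \<in> E" "m \<noteq> k" "m \<noteq> - k" for k m a h
    using sl[OF that(1,2)] that by (simp add: q u_minus algebra_simps)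
  have mv2: "(u m, q (u m) + a) \<in> \<Psi>"
    if "(u k, q (u k) + a) \<in> \<Psi>" "k \<in> E" "m \<in> E" "m \<noteq> k" "m \<noteq> - k" for k m a
  proof -
    have "- k \<noteq> m" "- k \<noteq> - m" using that by auto
    then show ?thesis using mv1[OF that(1), of m 0] qlong[of "- k" m] that by simp
  qed
  have mv: "(u m, q (u m) + a) \<in> \<Psi>" if a: "(u k, q (u k) + a) \<in> \<Psi>" "k \<in> E" "m \<in> E" for k m a
  proof -
    obtain j where j: "j \<in> E" "j \<noteq> k" "j \<noteq> - k" "k \<noteq> j" "k \<noteq> - j" using ex_third[OF a(2)] .
    consider "m = k" | "m = - k" | "m \<noteq> k" "m \<noteq> - k" by blast
    then show ?thesis
    proof cases
      case 1 then show ?thesis using a by simp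
    next
      case 2
      \<comment> \<open>No long root joins \<open>k\<close> to \<open>- k\<close>, so the transport
        makes a detour over another axis.\<close>
      have "(u j, q (u j) + a) \<in> \<Psi>" using mv2 a(1,2) j by blast
      moreover have "- k \<noteq> j" "- k \<noteq> - j" using j by auto
      ultimately show ?thesis using mv2 a j 2 by blast
    next
      case 3 then show ?thesis using mv2 a by blast
    qed
  qed
  have A_iff: "(u k, q (u k) + a) \<in> \<Psi> \<longleftrightarrow> a \<in> A" if "k \<in> E" for k a
    using mv[of k a 1] mv[of 1 a k] that E12(1) by (auto simp: A_def)
  have A0: "0 \<in> A" using q0[of 1] by (simp add: A_def)
  have H_iff: "(u k + u m, q (u k + u m) + h) \<in> \<Psi> \<longleftrightarrow> h \<in> H"
    if km: "k \<in> E" "m \<in> E" "k \<noteq> m" "k \<noteq> - m" for k m h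
  proof
    assume h: "(u k + u m, q (u k + u m) + h) \<in> \<Psi>"
    have ne: "m \<noteq> - k" "m \<noteq> k" using km by auto
    have "(u m, q (u m) + (0 + h)) \<in> \<Psi>" using mv1[of "- k" 0 m h] A_iff[of "- k" 0] A0 h km ne by auto
    moreover have "(q (u k + u m) + h) - q (u k + u m) \<in> L"
      using L_diff[OF mem(2)[OF _ _ _ h] qL] km by blast
    ultimately show "h \<in> H" using A_iff km unfolding H_def by simp
  next
    assume "h \<in> H"
    then have "(u k, q (u k) + h) \<in> \<Psi>" "h \<in> L" using A_iff km unfolding H_def by auto
    moreover have "q (u k) + h + q (u m) \<in> L"
      using L_add[OF qL[OF km(1,2)] \<open>h \<in> L\<close>] by (simp add: q algebra_simps)
    ultimately have "(u k + u m, q (u k) + h + q (u m)) \<in> \<Psi>"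
      using ss[of k "q (u k) + h" m "q (u m)"] q0 km by blast
    then show "(u k + u m, q (u k + u m) + h) \<in> \<Psi>" by (simp add: q algebra_simps)
  qed
  have AH: "a + h \<in> A" if "a \<in> A" "h \<in> H" for a h
    using mv1[of 1 a 2 h] A_iff[of 1 a] A_iff[of 2 "a + h"] H_iff[of "- 1" 2 h] that E12(1,2) by simp
  have An: "- a \<in> A" if "a \<in> A" for a
  proof -
    have "(u (- 1), - (q (u 1) + a)) \<in> \<Psi>" using neg that unfolding A_def by blast
    moreover have "- (q (u 1) + a) = q (u (- 1)) + - a" by (simp add: u_minus q)
    ultimately have "(u (- 1), q (u (- 1)) + - a) \<in> \<Psi>" by metis
    then show ?thesis using A_iff[of "- 1" "- a"] E12(1) by simp
  qed
  have AA: "a + b \<in> H" if "a \<in> A" "b \<in> A" "a + b \<in> L" for a b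
  proof -
    have m: "(u 1, q (u 1) + a) \<in> \<Psi>" "(u 2, q (u 2) + b) \<in> \<Psi>" using A_iff[of 1 a] A_iff[of 2 b] that E12 by auto
    have *: "q (u 1) + a + (q (u 2) + b) = q (u 1 + u 2) + (a + b)" by (simp add: q)
    have "q (u 1 + u 2) + (a + b) \<in> L" using L_add[OF qL that(3)] E12(1,2) by blast
    then have "(u 1 + u 2, q (u 1 + u 2) + (a + b)) \<in> \<Psi>"
      using ss[OF m] E12(1,2) unfolding * by simp
    then show ?thesis using H_iff[of 1 2 "a + b"] E12(1,2) by simp
  qed
  have AS: "q (u 1) + a \<in> S" if "a \<in> A" for a
    using mem(1)[OF E12(1)] that by (simp add: A_def)
  have ok: "sys_admissible q (\<lambda>_. True) (\<lambda>_. A) H"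
    unfolding sys_admissible_def
  proof (intro conjI allI ballI impI)
    show "linear q" by (rule lin)
    show "0 \<in> H" using A0 by (simp add: H_def)
    show "h - h' \<in> H" if "h \<in> H" "h' \<in> H" for h h'
    proof -
      have "- h' \<in> H" using that An L_neg by (simp add: H_def)
      moreover have "h \<in> A" using that by (simp add: H_def)
      ultimately have "h - h' \<in> A" using AH[of h "- h'"] by simp
      then show ?thesis using that L_diff by (simp add: H_def)
    qed
    show "- a \<in> A" if "a \<in> A" for a using An that .
    show "a + h \<in> A" if "a \<in> A" "h \<in> H" for a h using AH that .
    show "a + a \<in> H" if a: "a \<in> A" for a
    proof (rule AA[OF a a])
      \<comment> \<open>Here \<open>a\<close> itself need not lie in \<open>S\<close>; only
        \<open>q (u 1) + a\<close> does, so its double is compared with the double base point, which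
        is in \<open>L\<close>.\<close>
      have "(q (u 1) + a + (q (u 1) + a)) - q (u 1 + u 1) \<in> L"
        using L_diff[OF two_S[OF AS[OF a]] qL] E12(1) by blast
      then show "a + a \<in> L" by (simp add: q)
    qed
    show "a + b \<in> H" if "k \<in> E" "m \<in> E" "a \<in> A" "b \<in> A" "q (u k + u m) + (a + b) \<in> L" for k m a b
      using AA[OF that(3,4)] L_diff[OF that(5) qL[OF that(1,2)]] by simp
  qed auto
  moreover have "\<Psi> = sys q (\<lambda>_. True) (\<lambda>_. A) H \<inter> R"
  proof -
    have "(\<alpha>, y) \<in> \<Psi> \<longleftrightarrow> (\<alpha>, y) \<in> sys q (\<lambda>_. True) (\<lambda>_. A) H" if a: "(\<alpha>, y) \<in> R" for \<alpha> y
    proof -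
      have "(\<alpha>, y) \<in> RR" using a ambient_sub(1)[OF R] by auto
      then show ?thesis
      proof (cases rule: RR_cases)
        case (short k)
        then show ?thesis using A_iff[of k "y - q (u k)"] by simp
      next
        case (long k m)
        then show ?thesis using H_iff[of k m "y - q (u k + u m)"] by simp
      next
        case (div k)
        obtain m where m: "m \<in> E" "m \<noteq> k" "m \<noteq> - k" "k \<noteq> m" "k \<noteq> - m" using ex_third[OF div(1)] .
        define h where "h = y - q (u k + u k)"
        \<comment> \<open>Adding a base long root turns the divisible root into a long root over
          \<open>k\<close> and \<open>m\<close>, and another base long root leads back. Thus
          \<open>H\<close> decides membership over divisible roots too.\<close>
        have "(u k + u k, y) \<in> \<Psi> \<longleftrightarrow> h \<in> H"
        proof
          assume d: "(u k + u k, y) \<in> \<Psi>"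
          have "- k \<noteq> m" "- k \<noteq> - m" using m by auto
          then have "(u (- k) + u m, q (u (- k) + u m)) \<in> \<Psi>" using qlong m div by simp
          then have "(u k + u m, y + q (u (- k) + u m)) \<in> \<Psi>"
            using ll[OF d] m div E_nonzero(3) by auto
          moreover have "y + q (u (- k) + u m) = q (u k + u m) + h" by (simp add: h_def q u_minus)
          ultimately show "h \<in> H" using H_iff[of k m h] m div by simp
        next
          assume "h \<in> H"
          then have *: "(u k + u m, q (u k + u m) + h) \<in> \<Psi>" using H_iff m div by blast
          have **: "(u (- m) + u k, q (u (- m) + u k)) \<in> \<Psi>" using qlong[of "- m" k] m div by auto
          have e: "(u k + u m, q (u k + u m) + h) + (u (- m) + u k, q (u (- m) + u k)) = (u k + u k, y)"
            by (simp add: h_def q u_minus)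
          then show "(u k + u k, y) \<in> \<Psi>" using closed_in_sum[OF R cl * **] a div(2) unfolding e by simp
        qed
        then show ?thesis using div E_nonzero(3)[of k] by (simp add: h_def)
      qed
    qed
    then show ?thesis using closed_in_subset[OF R cl] by auto
  qed
  ultimately show ?thesis using that[of q "\<lambda>_. A" H] A0 qS qL by (simp add: full_sys_def)
qed

end

subsection \<open>The classification\<close>

lemma RR_eq: "RR = BR \<union> {(u k + u k, y) | k y. k \<in> E \<and> y \<in> D}"
proof
  show "RR \<subseteq> BR \<union> {(u k + u k, y) | k y. k \<in> E \<and> y \<in> D}"
  proof
    fix a assume "a \<in> RR"
    moreover obtain \<alpha> y where ay: "a = (\<alpha>, y)" by fastforce
    ultimately have "(\<alpha>, y) \<in> RR" by simp
    then show "a \<in> BR \<union> {(u k + u k, y) | k y. k \<in> E \<and> y \<in> D}"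
      by (cases rule: RR_cases) (auto simp: ay)
  qed
qed (use BR_sub_RR in auto)

lemma inter_RR_BR: "X \<inter> RR \<inter> BR = X \<inter> BR"
  using BR_sub_RR by blast

lemma sys_cong: "(\<And>k. k \<in> E \<Longrightarrow> c k = c' k) \<Longrightarrow> sys q c A H = sys q c' A H"
proof -
  have "sys q c A H \<subseteq> sys q c' A H" if cc: "\<And>k. k \<in> E \<Longrightarrow> c k = c' k" for c c'
  proof
    fix a assume a: "a \<in> sys q c A H"
    obtain \<alpha> y where ay: "a = (\<alpha>, y)" by fastforce
    from a[unfolded ay] have "(\<alpha>, y) \<in> sys q c' A H"
      by (cases rule: sys_cases) (simp_all flip: cc)
    then show "a \<in> sys q c' A H" using ay by simp
  qed
  moreover assume "\<And>k. k \<in> E \<Longrightarrow> c k = c' k"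
  ultimately show ?thesis by (metis subset_antisym)
qed

section \<open>The explicit systems and extensions of the statement in block form\<close>

lemma A_roots_iff:
  assumes "J \<subseteq> {1..n}"
  shows "\<alpha> \<in> A_roots n \<epsilon> J \<longleftrightarrow> (\<exists>k\<in>E. \<alpha> = u k + u k) \<or> (\<exists>k\<in>E. nat \<bar>k\<bar> \<in> J \<and> \<alpha> = u k) \<or>
    (\<exists>k\<in>E. \<exists>m\<in>E. k \<noteq> m \<and> k \<noteq> - m \<and> (nat \<bar>k\<bar> \<in> J \<longleftrightarrow> nat \<bar>m\<bar> \<in> J) \<and> \<alpha> = u k + u m)"
proof -
  have 1: "{\<sigma> *\<^sub>R (2 *\<^sub>R \<epsilon> i) | \<sigma> i. \<sigma> \<in> signs \<and> i \<in> {1..n}} = {\<alpha>. \<exists>k\<in>E. \<alpha> = u k + u k}"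
    using divisible_iff unfolding divisible_roots_def by blast
  have 2: "\<alpha> \<in> {\<sigma> *\<^sub>R \<epsilon> j | \<sigma> j. \<sigma> \<in> signs \<and> j \<in> J} \<longleftrightarrow> (\<exists>k\<in>E. nat \<bar>k\<bar> \<in> J \<and> \<alpha> = u k)"
  proof
    assume "\<alpha> \<in> {\<sigma> *\<^sub>R \<epsilon> j | \<sigma> j. \<sigma> \<in> signs \<and> j \<in> J}"
    then obtain \<sigma> j where "\<sigma> \<in> signs" "j \<in> J" "\<alpha> = \<sigma> *\<^sub>R \<epsilon> j" by blast
    then show "\<exists>k\<in>E. nat \<bar>k\<bar> \<in> J \<and> \<alpha> = u k" using assms signed_index[of \<sigma> j] by (metis subsetD)
  next
    assume "\<exists>k\<in>E. nat \<bar>k\<bar> \<in> J \<and> \<alpha> = u k"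
    then obtain k where k: "k \<in> E" "nat \<bar>k\<bar> \<in> J" "\<alpha> = u k" by blast
    obtain \<sigma> i where "\<sigma> \<in> signs" "i \<in> {1..n}" "u k = \<sigma> *\<^sub>R \<epsilon> i" "i = nat \<bar>k\<bar>"
      using index_signed[OF k(1)] .
    then show "\<alpha> \<in> {\<sigma> *\<^sub>R \<epsilon> j | \<sigma> j. \<sigma> \<in> signs \<and> j \<in> J}" using k by blast
  qed
  have 3: "\<alpha> \<in> {\<sigma> *\<^sub>R \<epsilon> r + \<tau> *\<^sub>R \<epsilon> s | \<sigma> \<tau> r s. \<sigma> \<in> signs \<and> \<tau> \<in> signs \<and>
        r \<in> {1..n} \<and> s \<in> {1..n} \<and> r \<noteq> s \<and> (r \<in> J \<and> s \<in> J \<or> r \<notin> J \<and> s \<notin> J)} \<longleftrightarrow>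
    (\<exists>k\<in>E. \<exists>m\<in>E. k \<noteq> m \<and> k \<noteq> - m \<and> (nat \<bar>k\<bar> \<in> J \<longleftrightarrow> nat \<bar>m\<bar> \<in> J) \<and> \<alpha> = u k + u m)"
    (is "?l \<longleftrightarrow> ?r")
  proof
    assume ?l
    then obtain \<sigma> \<tau> i j where a: "\<sigma> \<in> signs" "\<tau> \<in> signs" "i \<in> {1..n}" "j \<in> {1..n}" "i \<noteq> j"
      "\<alpha> = \<sigma> *\<^sub>R \<epsilon> i + \<tau> *\<^sub>R \<epsilon> j" "i \<in> J \<longleftrightarrow> j \<in> J"
      by blast
    obtain k where "k \<in> E" "\<sigma> *\<^sub>R \<epsilon> i = u k" "nat \<bar>k\<bar> = i" using signed_index a(1,3) .
    moreover obtain m where "m \<in> E" "\<tau> *\<^sub>R \<epsilon> j = u m" "nat \<bar>m\<bar> = j" using signed_index a(2,4) .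
    ultimately show ?r using a(5-7) nat_abs_eq_iff by metis
  next
    assume ?r
    then obtain k m where a: "k \<in> E" "m \<in> E" "k \<noteq> m" "k \<noteq> - m" "\<alpha> = u k + u m"
      "nat \<bar>k\<bar> \<in> J \<longleftrightarrow> nat \<bar>m\<bar> \<in> J" by blast
    obtain \<sigma> i where i: "\<sigma> \<in> signs" "i \<in> {1..n}" "u k = \<sigma> *\<^sub>R \<epsilon> i" "i = nat \<bar>k\<bar>"
      using index_signed a(1) .
    obtain \<tau> j where j: "\<tau> \<in> signs" "j \<in> {1..n}" "u m = \<tau> *\<^sub>R \<epsilon> j" "j = nat \<bar>m\<bar>"
      using index_signed a(2) .
    have "\<alpha> = \<sigma> *\<^sub>R \<epsilon> i + \<tau> *\<^sub>R \<epsilon> j" "i \<noteq> j" "i \<in> J \<and> j \<in> J \<or> i \<notin> J \<and> j \<notin> J"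
      using a i j nat_abs_eq_iff by metis+
    with i(1,2) j(1,2) show ?l by blast
  qed
  show ?thesis unfolding A_roots_def Un_iff 1 2 3 by blast
qed

lemma A_hat_eq:
  assumes "J \<subseteq> {1..n}"
  shows "A_hat n \<epsilon> \<Lambda> J = blk (\<lambda>k. nat \<bar>k\<bar> \<in> J) (\<lambda>b. if b then S else {}) \<inter> RR"
    (is "?l = ?X \<inter> RR")
proof -
  note iff = A_roots_iff[OF assms]
  have "(\<alpha>, y) \<in> ?l \<longleftrightarrow> (\<alpha>, y) \<in> ?X \<inter> RR" for \<alpha> y
  proof (cases "(\<alpha>, y) \<in> RR")
    case True
    then have "(\<alpha>, y) \<in> ?l \<longleftrightarrow> \<alpha> \<in> A_roots n \<epsilon> J" by (simp add: A_hat_def real_roots_def)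
    also from True have "\<dots> \<longleftrightarrow> (\<alpha>, y) \<in> ?X"
    proof (cases rule: RR_cases)
      case (short k)
      have "\<alpha> \<in> A_roots n \<epsilon> J \<longleftrightarrow> nat \<bar>k\<bar> \<in> J"
      proof
        assume "\<alpha> \<in> A_roots n \<epsilon> J"
        then show "nat \<bar>k\<bar> \<in> J"
          unfolding iff
        proof (elim disjE bexE conjE)
          fix j assume "j \<in> E" "\<alpha> = u j + u j"
          then show ?thesis using short_neq_sum[of k j j] short E_nonzero(3)[of j] by simp
        next
          fix j assume "j \<in> E" "nat \<bar>j\<bar> \<in> J" "\<alpha> = u j"
          then show ?thesis using u_eq_iff[of k j] short by simp
        next
          fix j p assume "j \<in> E" "p \<in> E" "j \<noteq> - p" "\<alpha> = u j + u p"
          then show ?thesis using short_neq_sum[of k j p] short by simp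
        qed
      next
        assume "nat \<bar>k\<bar> \<in> J"
        then show "\<alpha> \<in> A_roots n \<epsilon> J" unfolding iff using short by blast
      qed
      then show ?thesis using short by simp
    next
      case (long k m)
      have "\<alpha> \<in> A_roots n \<epsilon> J \<longleftrightarrow> (nat \<bar>k\<bar> \<in> J \<longleftrightarrow> nat \<bar>m\<bar> \<in> J)"
      proof
        assume "\<alpha> \<in> A_roots n \<epsilon> J"
        then show "nat \<bar>k\<bar> \<in> J \<longleftrightarrow> nat \<bar>m\<bar> \<in> J"
          unfolding iff
        proof (elim disjE bexE conjE)
          fix j assume "j \<in> E" "\<alpha> = u j + u j"
          then show ?thesis using u_sum_eq[of k m j j] long by metis
        next
          fix j assume "j \<in> E" "\<alpha> = u j"
          then show ?thesis using short_neq_sum[of j k m] long by metis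
        next
          fix j p assume "j \<in> E" "p \<in> E" "\<alpha> = u j + u p" "nat \<bar>j\<bar> \<in> J \<longleftrightarrow> nat \<bar>p\<bar> \<in> J"
          then show ?thesis using u_sum_eq[of k m j p] long by metis
        qed
      next
        assume "nat \<bar>k\<bar> \<in> J \<longleftrightarrow> nat \<bar>m\<bar> \<in> J"
        then show "\<alpha> \<in> A_roots n \<epsilon> J" unfolding iff using long by blast
      qed
      also have "\<dots> \<longleftrightarrow> (\<alpha>, y) \<in> ?X"
        unfolding long(5) mem_sys(2)[OF long(1,2,4)] using long(6) by simp
      finally show ?thesis .
    next
      case (div k)
      have "\<alpha> \<in> A_roots n \<epsilon> J" unfolding iff using div(1,2) by (intro disjI1 bexI[of _ k])
      moreover have "(\<alpha>, y) \<in> ?X"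
        unfolding div(2) mem_sys(2)[OF div(1,1) E_nonzero(3)[OF div(1)]] using D_sub_L[OF div(3)] by simp
      ultimately show ?thesis by simp
    qed
    finally show ?thesis using True by simp
  next
    case False
    have "A_roots n \<epsilon> J \<subseteq> BC"
      using iff BC_iff E_nonzero(3) by blast
    then show ?thesis using False by (auto simp: A_hat_def real_roots_def)
  qed
  then show ?thesis by auto
qed

text \<open>A divisible root involves one axis only, hence one colour, and its translations lie in
  \<open>D\<close>, which is part of \<open>L\<close>. So a two-block system contains every
  divisible real root.\<close>

lemma semi_closed_extension_blk:
  "semi_closed_extension n \<epsilon> \<Lambda> (blk c A \<inter> BR) = blk c A \<inter> RR"
proof -
  have "(\<Union>i\<in>{1..n}. \<Union>\<sigma>\<in>signs. {\<sigma> *\<^sub>R (2 *\<^sub>R \<epsilon> i)} \<times> D) = divisible_roots n \<epsilon> \<times> D"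
    unfolding divisible_roots_def by blast
  also have "\<dots> = {(u k + u k, y) | k y. k \<in> E \<and> y \<in> D}" using divisible_iff by blast
  also have "\<dots> = blk c A \<inter> \<dots>" using D_sub_L E_nonzero(3) by auto
  finally show ?thesis unfolding semi_closed_extension_def RR_eq by blast
qed

section \<open>Full gradient: passage between the two ambient sets\<close>

lemma cyc_succ_E:
  assumes "k \<in> E"
  defines "s \<equiv> int (cyc_succ n (nat \<bar>k\<bar>))"
  shows "s \<in> E" "s \<noteq> k" "s \<noteq> - k" "\<epsilon> (cyc_succ n (nat \<bar>k\<bar>)) = u s"
  using assms n2 by (auto simp: cyc_succ_def E_def u_def)

lemma full_extension_eq:
  "full_extension n \<epsilon> \<Lambda> X = X \<union> {(u k + u k, y) | k y. k \<in> E \<and> y \<in> D \<and>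
     (\<exists>a b. y = a + b \<and> a \<in> fibre \<Lambda> X (u k + u (- int (cyc_succ n (nat \<bar>k\<bar>)))) \<and>
       b \<in> fibre \<Lambda> X (u k + u (int (cyc_succ n (nat \<bar>k\<bar>)))))}" (is "_ = X \<union> ?Z")
proof -
  define F where "F v i = (fibre \<Lambda> X (v - \<epsilon> (cyc_succ n i)) + fibre \<Lambda> X (v + \<epsilon> (cyc_succ n i))) \<inter> D" for v i
  have F: "y \<in> F (u k) (nat \<bar>k\<bar>) \<longleftrightarrow> y \<in> D \<and>
     (\<exists>a b. y = a + b \<and> a \<in> fibre \<Lambda> X (u k + u (- int (cyc_succ n (nat \<bar>k\<bar>)))) \<and>
       b \<in> fibre \<Lambda> X (u k + u (int (cyc_succ n (nat \<bar>k\<bar>)))))" if "k \<in> E" for k y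
    using cyc_succ_E(4)[OF that] by (auto simp: F_def set_plus_def u_minus)
  have "(\<Union>i\<in>{1..n}. \<Union>\<sigma>\<in>signs. {\<sigma> *\<^sub>R (2 *\<^sub>R \<epsilon> i)} \<times> F (\<sigma> *\<^sub>R \<epsilon> i) i) =
    {(u k + u k, y) | k y. k \<in> E \<and> y \<in> F (u k) (nat \<bar>k\<bar>)}" (is "?U = ?V")
  proof
    have two: "\<sigma> *\<^sub>R (2 *\<^sub>R \<epsilon> i) = \<sigma> *\<^sub>R \<epsilon> i + \<sigma> *\<^sub>R \<epsilon> i" for \<sigma> i
      by (simp add: scaleR_2 scaleR_right_distrib)
    show "?U \<subseteq> ?V"
    proof
      fix a assume "a \<in> ?U"
      then obtain i \<sigma> y where i: "i \<in> {1..n}" "\<sigma> \<in> signs" "a = (\<sigma> *\<^sub>R \<epsilon> i + \<sigma> *\<^sub>R \<epsilon> i, y)"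
        "y \<in> F (\<sigma> *\<^sub>R \<epsilon> i) i" unfolding two by blast
      obtain k where "k \<in> E" "\<sigma> *\<^sub>R \<epsilon> i = u k" "nat \<bar>k\<bar> = i" using signed_index i(2,1) .
      then show "a \<in> ?V" using i by auto
    qed
    show "?V \<subseteq> ?U"
    proof
      fix a assume "a \<in> ?V"
      then obtain k y where k: "k \<in> E" "a = (u k + u k, y)" "y \<in> F (u k) (nat \<bar>k\<bar>)" by blast
      obtain \<sigma> i where "\<sigma> \<in> signs" "i \<in> {1..n}" "u k = \<sigma> *\<^sub>R \<epsilon> i" "i = nat \<bar>k\<bar>"
        using index_signed k(1) .
      then show "a \<in> ?U" unfolding two using k by auto
    qed
  qed
  also have "?V = ?Z" using F by blast
  finally show ?thesis unfolding full_extension_def F_def by simp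
qed

lemma full_extension_mono:
  "X \<subseteq> X' \<Longrightarrow> full_extension n \<epsilon> \<Lambda> X \<subseteq> full_extension n \<epsilon> \<Lambda> X'"
  unfolding full_extension_eq fibre_def by blast

text \<open>The fibres over the two long roots with sum \<open>u k + u k\<close> are cosets of
  \<open>H\<close> cut with \<open>L\<close>. As \<open>H\<close> is a group, their sums give
  translations in the coset that \<open>sys\<close> puts over the divisible root.\<close>

lemma full_extension_sys:
  assumes "full_sys q A H"
  shows "full_extension n \<epsilon> \<Lambda> (sys q (\<lambda>_. True) A H \<inter> BR) = sys q (\<lambda>_. True) A H \<inter> RR"
proof -
  let ?X = "sys q (\<lambda>_. True) A H"
  have lin: "linear q" and H0: "0 \<in> H" and Hd: "\<And>h h'. h \<in> H \<Longrightarrow> h' \<in> H \<Longrightarrow> h - h' \<in> H"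
    and qL: "\<And>k m. k \<in> E \<Longrightarrow> m \<in> E \<Longrightarrow> q (u k + u m) \<in> L"
    using assms unfolding full_sys_def sys_admissible_def by auto
  note q = linear_add[OF lin] linear_diff[OF lin] linear_neg[OF lin]
  have Ha: "h + h' \<in> H" if "h \<in> H" "h' \<in> H" for h h'
    using Hd[OF that(1) Hd[OF H0 that(2)]] by simp
  have fib: "y \<in> fibre \<Lambda> (?X \<inter> BR) (u k + u m) \<longleftrightarrow> y \<in> L \<and> y - q (u k + u m) \<in> H"
    if "k \<in> E" "m \<in> E" "k \<noteq> m" "k \<noteq> - m" for k m y
    using that by (auto simp: fibre_def)
  \<comment> \<open>Here \<open>s\<close> is any other axis: the cyclic successor in the formula
    matters only as a choice of one.\<close>
  have key: "(\<exists>a b. y = a + b \<and> a \<in> fibre \<Lambda> (?X \<inter> BR) (u k + u (- s)) \<and>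
      b \<in> fibre \<Lambda> (?X \<inter> BR) (u k + u s)) \<longleftrightarrow> (u k + u k, y) \<in> ?X" (is "?l \<longleftrightarrow> ?r")
    if k: "k \<in> E" "y \<in> D" and s: "s \<in> E" "s \<noteq> k" "s \<noteq> - k" for k s y
  proof -
    have ne: "k \<noteq> s" "k \<noteq> - s" "- s \<noteq> k" using s by auto
    have 1: "(u k + u k, y) \<in> ?X \<longleftrightarrow> y - q (u k + u k) \<in> H" using k E_nonzero(3) by simp
    have f1: "z \<in> fibre \<Lambda> (?X \<inter> BR) (u k + u (- s)) \<longleftrightarrow> z \<in> L \<and> z - q (u k + u (- s)) \<in> H" for z
      using fib[of k "- s"] k s ne by simp
    have f2: "z \<in> fibre \<Lambda> (?X \<inter> BR) (u k + u s) \<longleftrightarrow> z \<in> L \<and> z - q (u k + u s) \<in> H" for z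
      using fib[of k s] k s ne by simp
    have q2: "q (u k + u (- s)) + q (u k + u s) = q (u k + u k)" by (simp add: q u_minus)
    show ?thesis unfolding 1 f1 f2
    proof
      assume "\<exists>a b. y = a + b \<and> (a \<in> L \<and> a - q (u k + u (- s)) \<in> H) \<and> (b \<in> L \<and> b - q (u k + u s) \<in> H)"
      then obtain a b where ab: "y = a + b" "a - q (u k + u (- s)) \<in> H" "b - q (u k + u s) \<in> H" by blast
      have "(a - q (u k + u (- s))) + (b - q (u k + u s)) = y - q (u k + u k)"
        unfolding q2[symmetric] ab(1) by simp
      then show "y - q (u k + u k) \<in> H" using Ha[OF ab(2,3)] by simp
    next
      assume y: "y - q (u k + u k) \<in> H"
      \<comment> \<open>The base point is taken in the first fibre, and the remaining part of
        \<open>y\<close> then falls into the second.\<close>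
      let ?a = "q (u k + u (- s))"
      have a: "?a \<in> L" "?a - q (u k + u (- s)) \<in> H" using qL[of k "- s"] k s H0 by auto
      have "y - ?a \<in> L" using L_diff[OF D_sub_L[OF k(2)] a(1)] .
      moreover have "y - ?a - q (u k + u s) = y - q (u k + u k)" unfolding q2[symmetric] by simp
      moreover have "y = ?a + (y - ?a)" by simp
      ultimately show "\<exists>a b. y = a + b \<and> (a \<in> L \<and> a - q (u k + u (- s)) \<in> H) \<and> (b \<in> L \<and> b - q (u k + u s) \<in> H)"
        using a y by metis
    qed
  qed
  have cong: "{(u k + u k, y) | k y. k \<in> E \<and> y \<in> D \<and> P k y} = {(u k + u k, y) | k y. k \<in> E \<and> y \<in> D \<and> Q k y}"
    if "\<And>k y. k \<in> E \<Longrightarrow> y \<in> D \<Longrightarrow> P k y \<longleftrightarrow> Q k y" for P Q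
    using that by blast
  have "full_extension n \<epsilon> \<Lambda> (?X \<inter> BR) =
    (?X \<inter> BR) \<union> {(u k + u k, y) | k y. k \<in> E \<and> y \<in> D \<and> (u k + u k, y) \<in> ?X}"
    unfolding full_extension_eq
    by (rule arg_cong[where f = "(\<union>) (?X \<inter> BR)"], rule cong, rule key[OF _ _ cyc_succ_E(1-3)])
  then show ?thesis unfolding RR_eq by blast
qed

lemma full_sys_present:
  assumes "full_sys q A H" "ambient R" "k \<in> E"
  shows "(u k, q (u k)) \<in> sys q (\<lambda>_. True) A H \<inter> R"
    "m \<in> E \<Longrightarrow> k \<noteq> m \<Longrightarrow> k \<noteq> - m \<Longrightarrow> (u k + u m, q (u k + u m)) \<in> sys q (\<lambda>_. True) A H \<inter> R"
  using assms unfolding full_sys_def sys_admissible_def by auto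

text \<open>Presence of all short and long roots is inherited by larger systems, so they have the
  same shape, though possibly with another twist.\<close>

lemma full_sys_above:
  assumes "full_sys q A H" "ambient R" "closed_in R X" "sys q (\<lambda>_. True) A H \<inter> R \<subseteq> X"
  obtains q' A' H' where "full_sys q' A' H'" "X = sys q' (\<lambda>_. True) A' H' \<inter> R"
  using all_present[OF assms(2,3)] full_sys_present[OF assms(1,2)] assms(4) that by blast

lemma full_sys_closed: "full_sys q A H \<Longrightarrow> ambient R \<Longrightarrow> closed_in R (sys q (\<lambda>_. True) A H \<inter> R)"
  unfolding full_sys_def using closed_sys by blast

text \<open>On systems of this shape, intersecting with \<open>BR\<close> and applying
  \<open>full_extension\<close> are mutually inverse and monotone, and every larger closed system
  again has this shape. A competitor in one ambient set therefore gives one in the other.\<close>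

lemma full_sys_maximal_iff:
  assumes f: "full_sys q A H"
  defines "X \<equiv> sys q (\<lambda>_. True) A H"
  shows "maximal_closed_subroot_system BR (X \<inter> BR) \<longleftrightarrow> maximal_closed_subroot_system RR (X \<inter> RR)"
proof
  have ne: "X \<inter> R \<noteq> {}" if "ambient R" for R
    using full_sys_present(1)[OF f that E12(1)] unfolding X_def by blast
  have ext: "full_extension n \<epsilon> \<Lambda> (X \<inter> BR) = X \<inter> RR"
    unfolding X_def by (rule full_extension_sys[OF f])
  {
    assume m: "maximal_closed_subroot_system BR (X \<inter> BR)"
    show "maximal_closed_subroot_system RR (X \<inter> RR)"
    proof (rule maximalI)
      show "closed_in RR (X \<inter> RR)" unfolding X_def using full_sys_closed[OF f] by simp
      show "X \<inter> RR \<noteq> {}" using ne by simp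
      show "X \<inter> RR \<noteq> RR" using maximalD(3)[OF m] BR_sub_RR by blast
      fix Z assume Z: "closed_in RR Z" "X \<inter> RR \<subset> Z"
      then obtain q' A' H' where f': "full_sys q' A' H'" "Z = sys q' (\<lambda>_. True) A' H' \<inter> RR"
        using full_sys_above[OF f ambient_RR Z(1)] unfolding X_def by blast
      let ?Z = "sys q' (\<lambda>_. True) A' H' \<inter> BR"
      have Zs: "?Z = Z \<inter> BR" using f'(2) BR_sub_RR by blast
      have "closed_in BR ?Z" using full_sys_closed[OF f'(1)] by simp
      moreover have "X \<inter> BR \<subseteq> ?Z" using Z(2) Zs BR_sub_RR by blast
      moreover have "?Z \<noteq> X \<inter> BR"
      proof
        assume "?Z = X \<inter> BR"
        \<comment> \<open>Both sides are recovered from the same part over \<open>BR\<close> by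
          \<open>full_extension\<close>.\<close>
        then have "Z = X \<inter> RR" using full_extension_sys[OF f'(1)] ext f'(2) by metis
        then show False using Z by simp
      qed
      ultimately have "?Z = BR" using maximalD(4)[OF m] by blast
      then have "BR \<subseteq> Z" using Zs by blast
      then have "(u k, y) \<in> Z" if "k \<in> E" "y \<in> S" for k y
        using that mem_BR(1) by blast
      then show "Z = RR" using closed_eq_ambient[OF ambient_RR Z(1)] by blast
    qed
  }
  {
    assume m: "maximal_closed_subroot_system RR (X \<inter> RR)"
    show "maximal_closed_subroot_system BR (X \<inter> BR)"
    proof (rule maximalI)
      show "closed_in BR (X \<inter> BR)" unfolding X_def using full_sys_closed[OF f] by simp
      show "X \<inter> BR \<noteq> {}" using ne by simp
      show "X \<inter> BR \<noteq> BR"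
      proof
        assume "X \<inter> BR = BR"
        then have "(u k, y) \<in> X \<inter> RR" if "k \<in> E" "y \<in> S" for k y
          using that mem_BR(1) BR_sub_RR by blast
        then show False
          using closed_eq_ambient[OF ambient_RR maximalD(1)[OF m]] maximalD(3)[OF m] by blast
      qed
      fix Z assume Z: "closed_in BR Z" "X \<inter> BR \<subset> Z"
      then obtain q' A' H' where f': "full_sys q' A' H'" "Z = sys q' (\<lambda>_. True) A' H' \<inter> BR"
        using full_sys_above[OF f ambient_BR Z(1)] unfolding X_def by blast
      let ?Z = "sys q' (\<lambda>_. True) A' H' \<inter> RR"
      have "closed_in RR ?Z" using full_sys_closed[OF f'(1)] by simp
      moreover have "X \<inter> RR \<subseteq> ?Z"
        using full_extension_mono[of "X \<inter> BR" Z] Z(2) ext full_extension_sys[OF f'(1)] f'(2) by auto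
      moreover have "?Z \<noteq> X \<inter> RR" using Z(2) f'(2) inter_RR_BR by blast
      ultimately have "?Z = RR" using maximalD(4)[OF m] by blast
      then show "Z = BR" using f'(2) BR_sub_RR by blast
    qed
  }
qed

section \<open>Gradients of the two shapes\<close>

lemma gradient_iff: "\<alpha> \<in> gradient X \<longleftrightarrow> (\<exists>y. (\<alpha>, y) \<in> X)"
  by (simp add: gradient_def)

lemma full_gradient_sys:
  assumes "full_sys q A H"
  shows "full_gradient n \<epsilon> (sys q (\<lambda>_. True) A H \<inter> BR)"
proof -
  have "\<alpha> \<in> gradient (sys q (\<lambda>_. True) A H \<inter> BR)" if "\<alpha> \<in> B_roots n \<epsilon>" for \<alpha>
    using that full_sys_present[OF assms ambient_BR] unfolding B_iff gradient_iff by blast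
  then show ?thesis unfolding full_gradient_def by (auto simp: gradient_iff B_real_roots_def)
qed

text \<open>With both parts non-empty all short roots occur, but a long root occurs only within one
  colour, so short roots of different colours violate closedness. Nothing else does: a short plus a
  long root is never long, and long roots of the gradient occur with translation 0, so their sums
  stay in the closed system.\<close>

lemma semi_closed_blk:
  assumes s: "splits c A" and ne: "A True \<noteq> {}" "A False \<noteq> {}"
  shows "semi_closed_gradient n \<epsilon> (blk c A \<inter> BR)"
proof -
  let ?G = "gradient (blk c A \<inter> BR)"
  have AS: "A b \<subseteq> S" for b using s unfolding splits_def by (cases b) auto
  have sh: "u k \<in> ?G" if k: "k \<in> E" for k
  proof -
    obtain y where "y \<in> A (c k)" using ne by (cases "c k") auto
    then have "(u k, y) \<in> blk c A \<inter> BR" using k AS by auto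
    then show ?thesis unfolding gradient_iff by blast
  qed
  have lo: "u k + u m \<in> ?G \<longleftrightarrow> c k = c m" if "k \<in> E" "m \<in> E" "k \<noteq> m" "k \<noteq> - m" for k m
    using that unfolding gradient_iff by (auto intro: exI[of _ 0])
  obtain k m where km: "k \<in> E" "m \<in> E" "c k" "\<not> c m" "k \<noteq> m" "k \<noteq> - m"
    using s unfolding splits_def by metis
  then have "\<not> closed_gradient n \<epsilon> (blk c A \<inter> BR)"
    unfolding closed_gradient_def using sh lo[of k m] mem_B(2)[of k m] by blast
  moreover have "\<alpha> \<in> short_roots n \<epsilon> \<and> \<beta> \<in> short_roots n \<epsilon> \<and> \<alpha> + \<beta> \<in> long_roots n \<epsilon>"
    if a: "\<alpha> \<in> ?G" and b: "\<beta> \<in> ?G" and ab: "\<alpha> + \<beta> \<in> B_roots n \<epsilon> - ?G" for \<alpha> \<beta>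
  proof -
    have aB: "\<alpha> \<in> B_roots n \<epsilon>" "\<beta> \<in> B_roots n \<epsilon>" using a b by (auto simp: gradient_iff B_real_roots_def)
    have long: "\<alpha> + \<beta> \<in> long_roots n \<epsilon>" using ab sh unfolding B_roots_def short_iff Diff_iff Un_iff by metis
    have mixed: False if "\<alpha> \<in> short_roots n \<epsilon>" "\<beta> \<in> long_roots n \<epsilon>" "\<alpha> + \<beta> \<in> long_roots n \<epsilon>" for \<alpha> \<beta>
    proof -
      obtain j where j: "j \<in> E" "\<alpha> = u j" using \<open>\<alpha> \<in> short_roots n \<epsilon>\<close> unfolding short_iff by blast
      obtain p r where p: "p \<in> E" "r \<in> E" "p \<noteq> r" "p \<noteq> - r" "\<beta> = u p + u r"
        using \<open>\<beta> \<in> long_roots n \<epsilon>\<close> unfolding long_iff by blast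
      have "u j + (u p + u r) \<in> BC" using that j p by (auto simp: BC_roots_def)
      then have "j = - p \<or> j = - r" using root_sum_short j p by blast
      then have "\<alpha> + \<beta> = u r \<or> \<alpha> + \<beta> = u p" using j p by (auto simp: u_minus)
      then have "\<alpha> + \<beta> \<in> short_roots n \<epsilon>" using p mem_kinds(1) by metis
      then show False using that root_kinds_disjoint(1) by blast
    qed
    have "\<not> (\<alpha> \<in> long_roots n \<epsilon> \<and> \<beta> \<in> long_roots n \<epsilon>)"
    proof
      have L0: "(\<gamma>, 0) \<in> BR" if "\<gamma> \<in> long_roots n \<epsilon>" for \<gamma>
        using that unfolding long_iff by auto
      have 0: "(\<gamma>, 0) \<in> blk c A \<inter> BR" if g: "\<gamma> \<in> long_roots n \<epsilon>" "\<gamma> \<in> ?G" for \<gamma>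
      proof -
        obtain p r where p: "p \<in> E" "r \<in> E" "p \<noteq> r" "p \<noteq> - r" "\<gamma> = u p + u r"
          using g(1) unfolding long_iff by blast
        then have "c p = c r" using lo g(2) by blast
        then show ?thesis using p by simp
      qed
      assume "\<alpha> \<in> long_roots n \<epsilon> \<and> \<beta> \<in> long_roots n \<epsilon>"
      then have "(\<alpha>, 0) \<in> blk c A \<inter> BR" "(\<beta>, 0) \<in> blk c A \<inter> BR" using 0 a b by auto
      moreover have "(\<alpha>, 0) + (\<beta>, 0) \<in> BR" using L0[OF long] by simp
      ultimately have "(\<alpha>, 0) + (\<beta>, 0) \<in> blk c A \<inter> BR"
        using closed_in_sum[OF ambient_BR closed_sys[OF ambient_BR splits_admissible[OF s]]] by blast
      then have "\<alpha> + \<beta> \<in> ?G" unfolding gradient_iff by auto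
      then show False using ab by simp
    qed
    then show ?thesis using aB mixed[of \<alpha> \<beta>] mixed[of \<beta> \<alpha>] long unfolding B_roots_def
      by (auto simp: add.commute)
  qed
  ultimately show ?thesis unfolding semi_closed_gradient_def by blast
qed

lemma maximal_eq_blk:
  assumes "ambient R" "maximal_closed_subroot_system R X" "splits c A" "X \<subseteq> blk c A"
  shows "X = blk c A \<inter> R"
proof -
  have "X \<subseteq> R" using closed_in_subset[OF assms(1) maximalD(1)[OF assms(2)]] .
  then show ?thesis
    using maximalD(4)[OF assms(2) closed_sys[OF assms(1) splits_admissible[OF assms(3)]]]
      blk_proper(2)[OF assms(1,3)] assms(4) by blast
qed

text \<open>Semi-closedness supplies two occurring short roots whose sum is a long root that does
  not occur, which is the situation that forces two blocks.\<close>

lemma semi_closed_maximal: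
  assumes m: "maximal_closed_subroot_system BR X" and s: "semi_closed_gradient n \<epsilon> X"
  obtains c A where "splits c A" "X = blk c A \<inter> BR"
proof -
  note cl = maximalD(1)[OF m]
  obtain \<alpha> \<beta> where ab: "\<alpha> \<in> gradient X" "\<beta> \<in> gradient X" "\<alpha> + \<beta> \<in> B_roots n \<epsilon>" "\<alpha> + \<beta> \<notin> gradient X"
    "\<alpha> \<in> short_roots n \<epsilon>" "\<beta> \<in> short_roots n \<epsilon>"
    using s unfolding semi_closed_gradient_def closed_gradient_def by blast
  obtain i j where ij: "i \<in> E" "j \<in> E" "\<alpha> = u i" "\<beta> = u j" using ab(5,6) unfolding short_iff by blast
  have ne: "i \<noteq> - j" "i \<noteq> j"
    using ab(3) ij root_kinds_disjoint(4) div_not_B by (auto simp: BC_roots_def B_roots_def)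
  have miss: "(u i + u j, y) \<notin> X" for y using ab(4) ij unfolding gradient_iff by blast
  show ?thesis
  proof (cases "\<forall>k\<in>E. \<exists>y. (u k, y) \<in> X")
    case True
    then obtain c A where "splits c A" "X \<subseteq> blk c A"
      using some_long_missing[OF ambient_BR cl bspec[OF True] ij(1,2) ne(2,1) miss] by metis
    then show ?thesis using that maximal_eq_blk[OF ambient_BR m] by blast
  next
    \<comment> \<open>This case is contradictory: maximality would make \<open>X\<close> the system
      coloured by occurrence of short roots, and there \<open>i\<close> and \<open>j\<close> have
      the same colour, so their long root occurs.\<close>
    case False
    then obtain p where p: "p \<in> E" "\<And>y. (u p, y) \<notin> X" by blast
    obtain y where y: "(u i, y) \<in> X" using ab(1) ij unfolding gradient_iff by blast
    let ?c = "\<lambda>k. \<exists>y. (u k, y) \<in> X"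
    note * = some_short_missing[OF ambient_BR cl ij(1) y p]
    have "X = blk ?c (\<lambda>b. if b then S else {}) \<inter> BR" using maximal_eq_blk[OF ambient_BR m *] .
    moreover have "?c i" "?c j" using ab(1,2) ij unfolding gradient_iff by auto
    then have "(u i + u j, 0) \<in> blk ?c (\<lambda>b. if b then S else {}) \<inter> BR" using ij ne by simp
    ultimately show ?thesis using miss by metis
  qed
qed

section \<open>Systems with no or only some short roots\<close>

lemma A_hat_empty: "A_hat n \<epsilon> \<Lambda> {} = sys (\<lambda>_. 0) (\<lambda>_. False) (\<lambda>_. {}) L \<inter> RR"
proof -
  have "blk (\<lambda>k. nat \<bar>k\<bar> \<in> {}) (\<lambda>b. if b then S else {}) = sys (\<lambda>_. 0) (\<lambda>_. False) (\<lambda>_. {}) L"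
    by (simp add: sys_def)
  then show ?thesis using A_hat_eq[of "{}"] by simp
qed

text \<open>The second system contains the first and has the short roots with translations in
  \<open>L\<close> in addition; it is the one that destroys maximality when \<open>S\<close> differs
  from \<open>L\<close>.\<close>

lemma sys_admissible_const:
  "sys_admissible (\<lambda>_. 0) (\<lambda>_. False) (\<lambda>_. {}) L" "sys_admissible (\<lambda>_. 0) (\<lambda>_. False) (\<lambda>_. L) L"
  using L_diff L_neg L_add unfolding sys_admissible_def by (auto simp: linear_iff)

lemma A_hat_empty_closed: "closed_in RR (A_hat n \<epsilon> \<Lambda> {})" "A_hat n \<epsilon> \<Lambda> {} \<noteq> RR"
proof -
  show "closed_in RR (A_hat n \<epsilon> \<Lambda> {})"
    unfolding A_hat_empty using closed_sys[OF ambient_RR sys_admissible_const(1)] .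
  have "(u 1, 0) \<in> RR" "(u 1, 0) \<notin> A_hat n \<epsilon> \<Lambda> {}" unfolding A_hat_empty using E12(1) by simp_all
  then show "A_hat n \<epsilon> \<Lambda> {} \<noteq> RR" by blast
qed

text \<open>All long and divisible roots are present, so anything larger has a short root, whose
  translation is in \<open>L\<close> because \<open>S = L\<close>. Long roots with arbitrary
  translations in \<open>L\<close> move it to every index and translation; its own axis is reached
  by a detour over another one.\<close>

lemma A_hat_empty_maximal:
  assumes SL: "S = L"
  shows "maximal_closed_subroot_system RR (A_hat n \<epsilon> \<Lambda> {})"
proof (rule maximalI)
  show "closed_in RR (A_hat n \<epsilon> \<Lambda> {})" "A_hat n \<epsilon> \<Lambda> {} \<noteq> RR" by (rule A_hat_empty_closed)+
  have lo: "(u k + u m, y) \<in> A_hat n \<epsilon> \<Lambda> {}" if "k \<in> E" "m \<in> E" "k \<noteq> m" "k \<noteq> - m" "y \<in> L" for k m y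
    unfolding A_hat_empty using that by simp
  from lo[of 1 2 0] show "A_hat n \<epsilon> \<Lambda> {} \<noteq> {}" using E12(1,2) by auto
  fix X assume X: "closed_in RR X" "A_hat n \<epsilon> \<Lambda> {} \<subset> X"
  obtain \<alpha> y where a: "(\<alpha>, y) \<in> X" "(\<alpha>, y) \<notin> A_hat n \<epsilon> \<Lambda> {}"
    using X(2) by (metis psubset_imp_ex_mem Diff_iff surj_pair)
  then have "(\<alpha>, y) \<in> RR" using closed_in_subset[OF ambient_RR X(1)] by blast
  then obtain k where k: "k \<in> E" "(u k, y) \<in> X" "y \<in> L"
  proof (cases rule: RR_cases)
    case (short k) then show ?thesis using that a SL by simp
  next
    case (long k m) then show ?thesis using lo a by simp
  next
    case (div k) then show ?thesis using a D_sub_L E_nonzero(3)[of k] by (simp add: A_hat_empty)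
  qed
  have st: "(u m, z) \<in> X" if "k \<in> E" "(u k, y) \<in> X" "y \<in> L" "m \<in> E" "m \<noteq> k" "m \<noteq> - k" "z \<in> L" for k m y z
  proof -
    have "- k \<noteq> m" "- k \<noteq> - m" "k \<noteq> m" using that by auto
    then have "(u (- k) + u m, z - y) \<in> A_hat n \<epsilon> \<Lambda> {}" using lo[of "- k" m "z - y"] L_diff that by simp
    then have "(u (- k) + u m, z - y) \<in> X" using X(2) by blast
    from closed_in_short_long[OF ambient_RR X(1) that(2) this that(1,4) \<open>k \<noteq> m\<close>] show ?thesis by simp
  qed
  obtain j where j: "j \<in> E" "j \<noteq> k" "j \<noteq> - k" "k \<noteq> j" "k \<noteq> - j" using ex_third[OF k(1)] .
  have j0: "(u j, 0) \<in> X" using st[OF k j(1,2,3) L_0] .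
  have "(u m, z) \<in> X" if m: "m \<in> E" "z \<in> L" for m z
  proof (cases "m = k \<or> m = - k")
    case True
    then have "m \<noteq> j" "m \<noteq> - j" using j(2-5) by auto
    then show ?thesis using st[OF j(1) j0 L_0 m(1) _ _ m(2)] by blast
  next
    case False then show ?thesis using st[OF k m(1) _ _ m(2)] by blast
  qed
  then show "X = RR" using closed_eq_ambient[OF ambient_RR X(1)] SL by simp
qed

lemma maximal_A_hat_empty:
  assumes m: "maximal_closed_subroot_system RR X" and no: "\<And>k y. k \<in> E \<Longrightarrow> (u k, y) \<notin> X"
  shows "S = L" "X = A_hat n \<epsilon> \<Lambda> {}"
proof -
  note cl = maximalD(1)[OF m]
  \<comment> \<open>Without short roots the set \<open>A\<close> is arbitrary: the empty set
    identifies \<open>X\<close>, while \<open>L\<close> gives a closed system above \<open>X\<close>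
    containing short roots.\<close>
  have sub: "X \<subseteq> sys (\<lambda>_. 0) (\<lambda>_. False) (\<lambda>_. A) L \<inter> RR" for A
    using sub_blkI[OF ambient_RR cl, of "\<lambda>_. A" "\<lambda>_. False"] no closed_in_subset[OF ambient_RR cl] by simp
  then show X: "X = A_hat n \<epsilon> \<Lambda> {}" using maximalD(4)[OF m A_hat_empty_closed(1)] A_hat_empty_closed(2)
    unfolding A_hat_empty by blast
  let ?Z = "sys (\<lambda>_. 0) (\<lambda>_. False) (\<lambda>_. L) L \<inter> RR"
  show "S = L"
  proof (rule ccontr)
    assume "S \<noteq> L"
    then obtain y where y: "y \<in> S" "y \<notin> L" using L_sub_S by blast
    then have "(u 1, y) \<in> RR" "(u 1, y) \<notin> ?Z" using E12(1) by simp_all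
    then have "?Z = X" using maximalD(4)[OF m closed_sys[OF ambient_RR sys_admissible_const(2)] sub] by blast
    moreover have "(u 1, 0) \<in> ?Z" using E12(1) by simp
    ultimately show False using no[OF E12(1)] by blast
  qed
qed

lemma A_hat_split:
  assumes "J \<subset> {1..n}" "J \<noteq> {}"
  shows "splits (\<lambda>k. nat \<bar>k\<bar> \<in> J) (\<lambda>b. if b then S else {})"
proof -
  obtain i j where "i \<in> J" "i \<in> {1..n}" "j \<in> {1..n}" "j \<notin> J" using assms by blast
  then have "int i \<in> E" "nat \<bar>int i\<bar> \<in> J" "int j \<in> E" "nat \<bar>int j\<bar> \<notin> J" using E_nat(1) by auto
  then have "\<exists>k\<in>E. nat \<bar>k\<bar> \<in> J" "\<exists>k\<in>E. nat \<bar>k\<bar> \<notin> J" by blast+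
  then show ?thesis using S_neg S_add_L unfolding splits_def by simp
qed

lemma maximal_A_hat:
  assumes m: "maximal_closed_subroot_system RR X" and k: "k \<in> E" "(u k, y) \<in> X"
    and p: "p \<in> E" "\<And>y. (u p, y) \<notin> X"
  obtains J where "J \<subset> {1..n}" "J \<noteq> {}" "X = A_hat n \<epsilon> \<Lambda> J"
proof -
  define c where "c = (\<lambda>k. \<exists>y. (u k, y) \<in> X)"
  note * = some_short_missing[OF ambient_RR maximalD(1)[OF m] k p, folded c_def]
  define J where "J = {i \<in> {1..n}. c (int i)}"
  have cm: "c (- k) = c k" for k using *(1) unfolding splits_def by blast
  have c: "c k = (nat \<bar>k\<bar> \<in> J)" if "k \<in> E" for k
  proof -
    have "c (int (nat \<bar>k\<bar>)) = c k" using cm[of k] by (cases "k \<ge> 0") auto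
    moreover have "nat \<bar>k\<bar> \<in> {1..n}" using that by (auto simp: E_def)
    ultimately show ?thesis by (simp add: J_def)
  qed
  have "c k" "\<not> c p" using k p by (auto simp: c_def)
  then have "nat \<bar>k\<bar> \<in> J" "nat \<bar>p\<bar> \<notin> J" using c k p by auto
  moreover have "nat \<bar>p\<bar> \<in> {1..n}" using p by (auto simp: E_def)
  moreover have "J \<subseteq> {1..n}" unfolding J_def by blast
  ultimately have J: "J \<subset> {1..n}" "J \<noteq> {}" by blast+
  have "X = blk c (\<lambda>b. if b then S else {}) \<inter> RR" using maximal_eq_blk[OF ambient_RR m *] .
  also have "\<dots> = A_hat n \<epsilon> \<Lambda> J" using sys_cong[OF c] A_hat_eq J by simp
  finally show ?thesis using that J by blast
qed

text \<open>Forwards, a two-block system containing \<Psi> is proper and closed, so maximality turns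
  inclusion into equality. Backwards, the second case uses that the same colouring and parts give
  maximal systems in both ambient sets.\<close>

theorem classification:
  "maximal_closed_subroot_system RR \<Psi> \<longleftrightarrow>
    (\<exists>J. J \<subset> {1..n} \<and> (S \<noteq> L \<longrightarrow> J \<noteq> {}) \<and> \<Psi> = A_hat n \<epsilon> \<Lambda> J) \<or>
    (\<exists>\<Psi>'. maximal_closed_subroot_system BR \<Psi>' \<and>
      semi_closed_gradient n \<epsilon> \<Psi>' \<and> \<Psi> = semi_closed_extension n \<epsilon> \<Lambda> \<Psi>') \<or>
    (\<exists>\<Psi>'. maximal_closed_subroot_system BR \<Psi>' \<and>
      full_gradient n \<epsilon> \<Psi>' \<and> \<Psi> = full_extension n \<epsilon> \<Lambda> \<Psi>')" (is "_ \<longleftrightarrow> ?A \<or> ?B \<or> ?C")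
proof
  assume m: "maximal_closed_subroot_system RR \<Psi>"
  note cl = maximalD(1)[OF m]
  consider "\<And>k y. k \<in> E \<Longrightarrow> (u k, y) \<notin> \<Psi>"
    | k y p where "k \<in> E" "(u k, y) \<in> \<Psi>" "p \<in> E" "\<And>y. (u p, y) \<notin> \<Psi>"
    | i j where "\<And>k. k \<in> E \<Longrightarrow> \<exists>y. (u k, y) \<in> \<Psi>"
      "i \<in> E" "j \<in> E" "i \<noteq> j" "i \<noteq> - j" "\<And>y. (u i + u j, y) \<notin> \<Psi>"
    | "\<And>k. k \<in> E \<Longrightarrow> \<exists>y. (u k, y) \<in> \<Psi>"
      "\<And>k m. k \<in> E \<Longrightarrow> m \<in> E \<Longrightarrow> k \<noteq> m \<Longrightarrow> k \<noteq> - m \<Longrightarrow> \<exists>y. (u k + u m, y) \<in> \<Psi>"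
    by metis
  then show "?A \<or> ?B \<or> ?C"
  proof cases
    case 1
    have "{} \<subset> {1..n}" using n2 by auto
    then show ?thesis using maximal_A_hat_empty[OF m 1] by blast
  next
    case 2
    obtain J where "J \<subset> {1..n}" "J \<noteq> {}" "\<Psi> = A_hat n \<epsilon> \<Lambda> J"
      using maximal_A_hat[OF m 2] .
    then show ?thesis by blast
  next
    case 3
    obtain c A where s: "splits c A" "\<Psi> \<subseteq> blk c A" "A True \<noteq> {}" "A False \<noteq> {}"
      using some_long_missing[OF ambient_RR cl 3] .
    have "\<Psi> = semi_closed_extension n \<epsilon> \<Lambda> (blk c A \<inter> BR)"
      using maximal_eq_blk[OF ambient_RR m s(1,2)] semi_closed_extension_blk by simp
    then show ?thesis
      using blk_maximal[OF ambient_BR s(1)] semi_closed_blk[OF s(1,3,4)] by blast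
  next
    case 4
    obtain q A H where f: "full_sys q A H" "\<Psi> = sys q (\<lambda>_. True) A H \<inter> RR"
      using all_present[OF ambient_RR cl 4] .
    have "maximal_closed_subroot_system BR (sys q (\<lambda>_. True) A H \<inter> BR)"
      using full_sys_maximal_iff[OF f(1)] m f(2) by simp
    moreover have "\<Psi> = full_extension n \<epsilon> \<Lambda> (sys q (\<lambda>_. True) A H \<inter> BR)"
      using full_extension_sys[OF f(1)] f(2) by simp
    ultimately show ?thesis using full_gradient_sys[OF f(1)] by blast
  qed
next
  assume "?A \<or> ?B \<or> ?C"
  then show "maximal_closed_subroot_system RR \<Psi>"
  proof (elim disjE exE conjE)
    fix J assume J: "J \<subset> {1..n}" "S \<noteq> L \<longrightarrow> J \<noteq> {}" "\<Psi> = A_hat n \<epsilon> \<Lambda> J"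
    then show ?thesis
      using A_hat_empty_maximal blk_maximal[OF ambient_RR A_hat_split[of J]] A_hat_eq[of J]
      by (cases "J = {}") auto
  next
    fix \<Psi>' assume "maximal_closed_subroot_system BR \<Psi>'" "semi_closed_gradient n \<epsilon> \<Psi>'"
      "\<Psi> = semi_closed_extension n \<epsilon> \<Lambda> \<Psi>'"
    then show ?thesis
      using semi_closed_maximal semi_closed_extension_blk blk_maximal[OF ambient_RR] by metis
  next
    fix \<Psi>' assume m: "maximal_closed_subroot_system BR \<Psi>'" and g: "full_gradient n \<epsilon> \<Psi>'"
      and e: "\<Psi> = full_extension n \<epsilon> \<Lambda> \<Psi>'"
    have gr: "\<exists>y. (\<alpha>, y) \<in> \<Psi>'" if "\<alpha> \<in> B_roots n \<epsilon>" for \<alpha>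
      using g that unfolding full_gradient_def by (metis gradient_iff)
    obtain q A H where f: "full_sys q A H" "\<Psi>' = sys q (\<lambda>_. True) A H \<inter> BR"
      using all_present[OF ambient_BR maximalD(1)[OF m] gr gr] mem_B by blast
    then show ?thesis using full_sys_maximal_iff[OF f(1)] full_extension_sys[OF f(1)] m e by simp
  qed
qed

end

theorem theorem9:
  fixes \<epsilon> :: "nat \<Rightarrow> 'v::euclidean_space"
    and Y :: "'y::real_vector set"
    and \<Lambda> :: "'v \<Rightarrow> 'y set"
    and \<Psi> :: "('v \<times> 'y) set"
    and n :: nat
  assumes "n \<ge> 2"
    and "orthonormal_basis n \<epsilon>"
    and "extension_datum n \<epsilon> Y \<Lambda>"
    and "n = 2 \<Longrightarrow> add_subgroup (Lambda_l \<epsilon> \<Lambda>) Y"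
    and "\<Psi> \<subseteq> affine_system n \<epsilon> \<Lambda>"
  shows "maximal_closed_subroot_system (real_roots n \<epsilon> \<Lambda>) \<Psi> \<longleftrightarrow>
    (\<exists>J. J \<subset> {1..n} \<and> (Lambda_s \<epsilon> \<Lambda> \<noteq> Lambda_l \<epsilon> \<Lambda> \<longrightarrow> J \<noteq> {}) \<and> \<Psi> = A_hat n \<epsilon> \<Lambda> J) \<or>
    (\<exists>\<Psi>'. maximal_closed_subroot_system (B_real_roots n \<epsilon> \<Lambda>) \<Psi>' \<and>
      semi_closed_gradient n \<epsilon> \<Psi>' \<and> \<Psi> = semi_closed_extension n \<epsilon> \<Lambda> \<Psi>') \<or>
    (\<exists>\<Psi>'. maximal_closed_subroot_system (B_real_roots n \<epsilon> \<Lambda>) \<Psi>' \<and>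
      full_gradient n \<epsilon> \<Psi>' \<and> \<Psi> = full_extension n \<epsilon> \<Lambda> \<Psi>')"
proof -
  interpret BC_datum n \<epsilon> Y \<Lambda>
    using assms(1-4) by unfold_locales auto
  show ?thesis by (rule classification)
qed

end
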